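(* Let $(P,r)$ be a finite graded poset, and suppose that $\varDelta(P)$ gives a triangulation of a homology $n$-manifold $X$ without boundary. Then for $0\le k\le n$, $\varDelta^{(k)}(P)$ is not contractible.
   Context: A topological space $X$ is a homology $n$-manifold (without boundary) if for every $x\in X$ the local homology $H_i(X,X\setminus\{x\};\mathbb{Z})$ is $0$ for $i\ne n$ and is isomorphic to $\mathbb{Z}$ for $i=n$. A finite poset $P$ is graded of rank $m\ge 0$ if every maximal chain of $P$ has length $m$ (i.e. $m+1$ elements); its rank function $r$ satisfies $r(x)=0$ for $x$ minimal and $r(y)=r(x)+1$ if $y$ covers $x$. The order complex $\varDelta(P)$ is the abstract simplicial complex whose simplices are the chains of $P$, and $\varDelta^{(k)}(P)=\{(x_0<\cdots<x_l)\mid r(x_l)-r(x_0)\le k\}\subseteq\varDelta(P)$.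
   Formalization: The case n = 0 with P a one-point poset is excluded: there Δ(P) is a point, which is a homology 0-manifold, and Δ^(0)(P) is that same point, which is contractible, so the claim as stated fails. *)

theory Defs
  imports "HOL-Homology.Homology"
begin

definition homology_manifold :: "nat \<Rightarrow> 'a topology \<Rightarrow> bool" where
  "homology_manifold n X \<longleftrightarrow>
     (\<forall>x \<in> topspace X. \<forall>i::int.
        if i = int n
        then relative_homology_group i X (topspace X - {x}) \<cong> integer_group
        else trivial_group (relative_homology_group i X (topspace X - {x})))"

text \<open>A poset is a set \<open>P\<close> with a relation \<open>R\<close>, where \<open>(x, y) \<in> R\<close> means \<open>x \<le> y\<close>.
  \<open>partial_order_on P R\<close> includes \<open>R \<subseteq> P \<times> P\<close>, so every member of \<open>Chains R\<close> lies in \<open>P\<close>.\<close>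

definition maximal_chain :: "'a rel \<Rightarrow> 'a set \<Rightarrow> bool" where
  "maximal_chain R C \<longleftrightarrow> C \<in> Chains R \<and> (\<forall>D \<in> Chains R. C \<subseteq> D \<longrightarrow> D = C)"

definition minimal_in :: "'a set \<Rightarrow> 'a rel \<Rightarrow> 'a \<Rightarrow> bool" where
  "minimal_in P R x \<longleftrightarrow> x \<in> P \<and> (\<forall>z. (z, x) \<in> R \<longrightarrow> z = x)"

definition covers :: "'a rel \<Rightarrow> 'a \<Rightarrow> 'a \<Rightarrow> bool" where
  "covers R y x \<longleftrightarrow> (x, y) \<in> R \<and> x \<noteq> y \<and>
     (\<forall>z. (x, z) \<in> R \<longrightarrow> (z, y) \<in> R \<longrightarrow> z = x \<or> z = y)"

text \<open>The empty poset is not graded: its only maximal chain has no elements.\<close>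

definition graded_of_rank :: "'a rel \<Rightarrow> nat \<Rightarrow> bool" where
  "graded_of_rank R m \<longleftrightarrow> (\<forall>C. maximal_chain R C \<longrightarrow> card C = m + 1)"

definition rank_function :: "'a set \<Rightarrow> 'a rel \<Rightarrow> ('a \<Rightarrow> nat) \<Rightarrow> bool" where
  "rank_function P R r \<longleftrightarrow>
     (\<forall>x. minimal_in P R x \<longrightarrow> r x = 0) \<and> (\<forall>x y. covers R y x \<longrightarrow> r y = r x + 1)"

definition finite_graded_poset :: "'a set \<Rightarrow> 'a rel \<Rightarrow> ('a \<Rightarrow> nat) \<Rightarrow> bool" where
  "finite_graded_poset P R r \<longleftrightarrow>
     finite P \<and> partial_order_on P R \<and> (\<exists>m. graded_of_rank R m) \<and> rank_function P R r"

definition order_complex :: "'a rel \<Rightarrow> 'a set set" where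
  "order_complex R = {C. finite C \<and> C \<noteq> {} \<and> C \<in> Chains R}"

text \<open>Here \<open>x\<close> and \<open>y\<close> are the least and greatest elements \<open>x\<^sub>0\<close> and \<open>x\<^sub>l\<close> of the chain;
  the rank condition \<open>r x\<^sub>l - r x\<^sub>0 \<le> k\<close> is written without subtraction.\<close>

definition bounded_order_complex :: "nat \<Rightarrow> 'a rel \<Rightarrow> ('a \<Rightarrow> nat) \<Rightarrow> 'a set set" where
  "bounded_order_complex k R r =
     {C \<in> order_complex R.
        \<exists>x \<in> C. \<exists>y \<in> C. (\<forall>z \<in> C. (x, z) \<in> R \<and> (z, y) \<in> R) \<and> r y \<le> r x + k}"

text \<open>Points of the realization are given by barycentric coordinates. The subspace topology of
  the product topology is the usual topology when the complex has finitely many vertices.\<close>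

definition geometric_realization :: "'a set set \<Rightarrow> ('a \<Rightarrow> real) topology" where
  "geometric_realization K =
     subtopology (powertop_real UNIV)
       {t. (\<forall>v. 0 \<le> t v) \<and> {v. t v \<noteq> 0} \<in> K \<and> (\<Sum>v | t v \<noteq> 0. t v) = 1}"

definition triangulates :: "'a set set \<Rightarrow> 'b topology \<Rightarrow> bool" where
  "triangulates K X \<longleftrightarrow> geometric_realization K homeomorphic_space X"

end

theory Submission
  imports Defs
begin

text \<open>If every ridge of the order complex lies in exactly two facets, then the chains of ranks
  \<open>0, \<dots>, k\<close> that are completed to a facet by the upper part of one fixed facet have as sum a nonzero
  cycle modulo 2 in the \<open>k\<close>-dimensional complex \<open>\<Delta>\<^sup>(\<^sup>k\<^sup>)(P)\<close>. Its singular lift \<open>c\<close> satisfies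
  \<open>\<partial>c = 2d\<close>. If the complex were contractible, then \<open>d\<close> would bound, hence \<open>c = 2e + \<partial>f\<close>; this is
  excluded by Sperner's lemma, read as the evaluation on small simplices of a cocycle modulo 2 that counts
  the simplices carrying all labels.

  Excision reduces the local homology at the barycentre of a ridge to that of its star, a book whose pages
  are the facets through the ridge. One page has trivial local homology, two pages have nontrivial
  local homology (Sperner again), and from three pages on the group contains two independent summands,
  so it is not infinite cyclic. The local homology at the barycentre of a facet determines the
  dimension.\<close>

section \<open>Sperner's lemma for singular chains\<close>

text \<open>Cycles are taken modulo 2 because \<open>X\<close> need not be orientable: two facets
  through each ridge give a fundamental class modulo 2, in general no integral one. All groups are
  integral, so a cycle modulo 2 appears as an integral chain whose boundary is twice another chain.
  The chains that witness vanishing homology are arbitrary singular chains, not simplicial ones.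
  Therefore the points of the realization are labelled, by a function that is not continuous, and
  only the vertices of singular simplices are inspected; subdivision brings each simplex into an
  open set that restricts its labels. One obstruction serves three times: for the cycle in the
  bounded complex, at a facet and for two pages, which explains its summands. The upper part of the
  facet is kept fixed so that the lower parts are the facets of its link: a ridge of the link
  together with the upper part is a ridge of the whole complex. For \<open>k = 0\<close> there are
  only vertices, and connectedness decides.\<close>

definition simplex_vertex :: "'a \<Rightarrow> 'a \<Rightarrow> real" where
  "simplex_vertex a = (\<lambda>b. if b = a then 1 else 0)"

lemma simplex_vertex_in [simp]: "simplex_vertex j \<in> standard_simplex p \<longleftrightarrow> j \<le> p"
proof -
  have "simplex_vertex j = (\<lambda>i. if i = j then 1 else 0)"
    by (simp add: simplex_vertex_def)
  then show ?thesis by simp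
qed

definition vertex_labels :: "nat \<Rightarrow> ('b \<Rightarrow> nat) \<Rightarrow> ((nat \<Rightarrow> real) \<Rightarrow> 'b) \<Rightarrow> nat set" where
  "vertex_labels p L s = (\<lambda>j. L (s (simplex_vertex j))) ` {..p}"

text \<open>The linear extension of an indicator function. The target of \<open>frag_extend\<close>
  is the free abelian group on the single generator \<open>()\<close>, whose coefficient is read off
  as an integer.\<close>

definition rainbow_count :: "nat \<Rightarrow> ('b \<Rightarrow> nat) \<Rightarrow> 'b chain \<Rightarrow> int" where
  "rainbow_count p L c =
     Poly_Mapping.lookup (frag_extend (\<lambda>s. if vertex_labels p L s = {..p} then frag_of () else 0) c) ()"

lemma rainbow_count_of:
  "rainbow_count p L (frag_of s) = (if vertex_labels p L s = {..p} then 1 else 0)"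
  by (simp add: rainbow_count_def)

lemma rainbow_count_0 [simp]: "rainbow_count p L 0 = 0"
  by (simp add: rainbow_count_def)

lemma rainbow_count_add: "rainbow_count p L (a + b) = rainbow_count p L a + rainbow_count p L b"
  by (simp add: rainbow_count_def frag_extend_add lookup_add)

lemma rainbow_count_diff: "rainbow_count p L (a - b) = rainbow_count p L a - rainbow_count p L b"
  by (simp add: rainbow_count_def frag_extend_diff lookup_minus)

lemma rainbow_count_cmul: "rainbow_count p L (frag_cmul k a) = k * rainbow_count p L a"
  by (simp add: rainbow_count_def frag_extend_cmul)

lemma rainbow_count_sum: "rainbow_count p L (sum f I) = (\<Sum>i\<in>I. rainbow_count p L (f i))"
  by (induction I rule: infinite_finite_induct) (auto simp: rainbow_count_add)

lemma rainbow_count_eq_0: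
  assumes "\<And>s. s \<in> Poly_Mapping.keys c \<Longrightarrow> vertex_labels p L s \<noteq> {..p}"
  shows "rainbow_count p L c = 0"
  unfolding rainbow_count_def using assms by (subst frag_extend_eq_0) auto

text \<open>If some omission leaves all labels \<open>0, ..., p\<close>, then by hypothesis there
  are no other labels, so \<open>p + 2\<close> vertices share \<open>p + 1\<close> labels and
  exactly one label occurs twice. Omitting either of its two carriers works, and nothing else does.
  With a further label besides \<open>0, ..., p\<close> just one omission would work; this is what
  the hypothesis excludes.\<close>

lemma even_card_omissions:
  fixes l :: "nat \<Rightarrow> nat"
  assumes "\<not> {..p} \<subset> l ` {..Suc p}"
  shows "even (card {k. k \<le> Suc p \<and> l ` ({..Suc p} - {k}) = {..p}})" (is "even (card ?K)")
proof (cases "?K = {}")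
  case False
  define A where "A = {..Suc p}"
  have A: "finite A" "card A = Suc (Suc p)" by (auto simp: A_def)
  have K: "?K = {k \<in> A. l ` (A - {k}) = {..p}}" by (auto simp: A_def)
  then obtain k where k: "k \<in> A" "l ` (A - {k}) = {..p}" using False by blast
  have lA: "l ` A = {..p}" using assms k unfolding A_def[symmetric] by blast
  then have "l k \<in> l ` (A - {k})" using k by blast
  then obtain a where a: "a \<in> A" "a \<noteq> k" "l a = l k" by force
  have "card (l ` (A - {k})) = card (A - {k})" using k A by simp
  then have inj: "inj_on l (A - {k})"
    using A by (intro eq_card_imp_inj_on) auto
  have "j = k \<or> j = a" if j: "j \<in> A" "l ` (A - {j}) = {..p}" for j
  proof (rule ccontr)
    assume n: "\<not> (j = k \<or> j = a)"
    have "l j \<in> l ` (A - {j})" using lA j by blast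
    then obtain i where i: "i \<in> A" "i \<noteq> j" "l i = l j" by force
    \<comment> \<open>An index equal to \<open>k\<close> is exchanged for its twin \<open>a\<close>,
      so that the coincidence with \<open>j\<close> takes place in \<open>A - {k}\<close>, where
      \<open>l\<close> is injective.\<close>
    define i' where "i' = (if i = k then a else i)"
    have "i' \<in> A - {k}" "l i' = l j" "i' \<noteq> j" using i a n by (auto simp: i'_def)
    then show False using inj_onD[OF inj, of i' j] n j by blast
  qed
  moreover have "l ` (A - {a}) = l ` A"
  proof -
    have "l i \<in> l ` (A - {a})" if "i \<in> A" for i
      using that a k(1) by (intro image_eqI[of _ _ "if i = a then k else i"]) auto
    then show ?thesis by blast
  qed
  ultimately have "?K = {k, a}" unfolding K using k a(1) lA by auto
  then show ?thesis using a(2) by simp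
next
  case True
  then show ?thesis by (simp only: card.empty even_zero)
qed

definition skip :: "nat \<Rightarrow> nat \<Rightarrow> nat" where
  "skip k j = (if j < k then j else Suc j)"

lemma inj_skip: "inj_on (skip k) A"
  by (auto simp: inj_on_def skip_def split: if_splits)

lemma image_skip:
  assumes "k \<le> Suc p"
  shows "skip k ` {..p} = {..Suc p} - {k}"
proof (intro equalityI subsetI)
  fix j assume j: "j \<in> {..Suc p} - {k}"
  then have "j = skip k (if j < k then j else j - 1)" "(if j < k then j else j - 1) \<le> p"
    using assms by (auto simp: skip_def)
  then show "j \<in> skip k ` {..p}" by blast
qed (use assms in \<open>auto simp: skip_def split: if_splits\<close>)

lemma vertex_labels_singular_face:
  assumes "k \<le> Suc p"
  shows "vertex_labels p L (singular_face (Suc p) k s) =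
         (\<lambda>j. L (s (simplex_vertex j))) ` ({..Suc p} - {k})"
proof -
  have "simplical_face k (simplex_vertex j) = simplex_vertex (skip k j)" for j
    by (auto simp: simplical_face_def simplex_vertex_def skip_def fun_eq_iff)
  then have "vertex_labels p L (singular_face (Suc p) k s) =
      (\<lambda>j. L (s (simplex_vertex j))) ` skip k ` {..p}"
    by (auto simp: vertex_labels_def singular_face_def image_image)
  then show ?thesis by (simp only: image_skip[OF assms])
qed

text \<open>Modulo 2 the signs disappear, and the count over the faces of one simplex is the number
  of omissions that keep all labels.\<close>

lemma even_rainbow_count_boundary:
  assumes "\<And>s. s \<in> Poly_Mapping.keys c \<Longrightarrow> \<not> {..p} \<subset> vertex_labels (Suc p) L s"
  shows "even (rainbow_count p L (chain_boundary (Suc p) c))"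
proof -
  have "Poly_Mapping.keys c \<subseteq> {s. \<not> {..p} \<subset> vertex_labels (Suc p) L s}"
    using assms by auto
  then show ?thesis
  proof (induction c rule: frag_induction)
    case (one s)
    let ?l = "\<lambda>j. L (s (simplex_vertex j))"
    let ?K = "{k. k \<le> Suc p \<and> ?l ` ({..Suc p} - {k}) = {..p}}"
    have "rainbow_count p L (chain_boundary (Suc p) (frag_of s))
        = (\<Sum>k\<le>Suc p. (-1) ^ k * (if ?l ` ({..Suc p} - {k}) = {..p} then 1 else 0))"
      unfolding chain_boundary_of
      by (auto simp: rainbow_count_sum rainbow_count_cmul rainbow_count_of vertex_labels_singular_face
          simp del: sum.atMost_Suc intro!: sum.cong)
    also have "even \<dots> \<longleftrightarrow> even (card {k \<in> {..Suc p}. odd ((-1) ^ k * (if ?l ` ({..Suc p} - {k}) = {..p} then 1 else (0::int)))})"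
      by (rule even_sum_iff) simp
    also have "{k \<in> {..Suc p}. odd ((-1) ^ k * (if ?l ` ({..Suc p} - {k}) = {..p} then 1 else (0::int)))} = ?K"
      by auto
    also have "even (card ?K)"
      using one by (intro even_card_omissions) (auto simp: vertex_labels_def)
    finally show ?case .
  qed (auto simp: chain_boundary_diff rainbow_count_diff)
qed

lemma rainbow_count_missing_label:
  assumes "singular_chain p (subtopology X {x. L x \<noteq> i}) c" "i \<le> p"
  shows "rainbow_count p L c = 0"
proof (rule rainbow_count_eq_0)
  fix s assume "s \<in> Poly_Mapping.keys c"
  then have "s ` standard_simplex p \<subseteq> {x. L x \<noteq> i}"
    using assms by (auto simp: singular_chain_subtopology)
  then have "L (s (simplex_vertex j)) \<noteq> i" if "j \<le> p" for j
    using simplex_vertex_in[of j p] that by blast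
  then have "i \<notin> vertex_labels p L s"
    by (auto simp: vertex_labels_def)
  then show "vertex_labels p L s \<noteq> {..p}" using assms(2) by auto
qed

section \<open>Iterated subdivision and the obstruction from Sperner's lemma\<close>

lemma singular_subdivision_power_minus:
  "(singular_subdivision p ^^ n) (- a) = - (singular_subdivision p ^^ n) a"
  using singular_subdivision_power_diff[where a=0 and b=a] by simp

lemma singular_subdivision_power_add:
  "(singular_subdivision p ^^ n) (a + b) = (singular_subdivision p ^^ n) a + (singular_subdivision p ^^ n) b"
  using singular_subdivision_power_diff[where a=a and b="- b"]
  by (simp add: singular_subdivision_power_minus)

lemma singular_chain_subdivision_power:
  "singular_chain p X c \<Longrightarrow> singular_chain p X ((singular_subdivision p ^^ n) c)"
  by (induction n) (auto simp: singular_chain_singular_subdivision)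

lemma chain_boundary_subdivision_power:
  assumes "singular_chain p X c"
  shows "chain_boundary p ((singular_subdivision p ^^ n) c)
       = (singular_subdivision (p - Suc 0) ^^ n) (chain_boundary p c)"
proof (induction n)
  case (Suc n)
  then show ?case
    using chain_boundary_singular_subdivision[OF singular_chain_subdivision_power[OF assms, of n]]
    by simp
qed auto

text \<open>The chain homotopy from the iterated subdivision to the identity sends a face
  into its own image, where a label is missing, so that subdividing does not change the parity.\<close>

lemma odd_rainbow_count_subdivision:
  assumes s: "singular_simplex p X s"
    and le: "\<And>x. x \<in> standard_simplex p \<Longrightarrow> L (s x) \<le> p"
    and face: "\<And>x i. \<lbrakk>x \<in> standard_simplex p; i \<le> p; x i = 0\<rbrakk> \<Longrightarrow> L (s x) \<noteq> i"
  shows "odd (rainbow_count p L ((singular_subdivision p ^^ n) (frag_of s)))"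
proof -
  obtain h where
        h0: "\<And>p. h p 0 = (0 :: 'a chain)"
    and hd: "\<And>p c1 c2. h p (c1-c2) = h p c1 - h p c2"
    and hc: "\<And>p X c. singular_chain p X c \<Longrightarrow> singular_chain (Suc p) X (h p c)"
    and hb: "\<And>p X c. singular_chain p X c
                 \<Longrightarrow> chain_boundary (Suc p) (h p c) + h (p - Suc 0) (chain_boundary p c)
                   = (singular_subdivision p ^^ n) c - c"
    using chain_homotopic_iterated_singular_subdivision[of n] by metis
  \<comment> \<open>All coordinates of the vertex \<open>j\<close> other than the
    \<open>j\<close>-th vanish, and by \<open>face\<close> a label is never the index of a vanishing
    coordinate.\<close>
  have L: "L (s (simplex_vertex j)) = j" if "j \<le> p" for j
  proof (rule ccontr)
    assume "L (s (simplex_vertex j)) \<noteq> j"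
    then have "simplex_vertex j (L (s (simplex_vertex j))) = 0"
      by (simp add: simplex_vertex_def)
    then show False
      using face[of "simplex_vertex j" "L (s (simplex_vertex j))"] le[of "simplex_vertex j"] that
      by simp
  qed
  have 1: "rainbow_count p L (frag_of s) = 1"
    using L by (simp add: rainbow_count_of vertex_labels_def)
  \<comment> \<open>The homotopy \<open>h\<close> is one family for all spaces, so it maps chains of
    a subspace to chains of that subspace. Applied to the region where labels are at most
    \<open>p\<close>, this prevents any further label.\<close>
  have sc: "singular_chain p (subtopology X {x. L x \<le> p}) (frag_of s)"
    using s le by (auto simp: singular_chain_of singular_simplex_subtopology)
  have "singular_chain (Suc p) (subtopology X {x. L x \<le> p}) (h p (frag_of s))"
    using hc sc by blast
  then have "vertex_labels (Suc p) L t \<subseteq> {..p}" if "t \<in> Poly_Mapping.keys (h p (frag_of s))" for t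
    unfolding vertex_labels_def using that simplex_vertex_in
    by (fastforce simp: singular_chain_subtopology image_subset_iff)
  then have 2: "even (rainbow_count p L (chain_boundary (Suc p) (h p (frag_of s))))"
    by (intro even_rainbow_count_boundary) blast
  have 3: "rainbow_count p L (h (p - Suc 0) (chain_boundary p (frag_of s))) = 0"
  proof (cases "p = 0")
    case False
    have hminus: "h q (- c) = - h q c" for q c using hd[of q 0 c] h0 by simp
    have hadd: "h q (c + d) = h q c + h q d" for q c d using hd[of q c "- d"] hminus by simp
    have hcmul: "h q (frag_cmul ((-1) ^ k) c) = frag_cmul ((-1) ^ k) (h q c)" for q c and k :: nat
      by (cases "even k") (auto simp: hminus)
    have hsum: "h q (sum c I) = (\<Sum>i\<in>I. h q (c i))" for q I and c :: "nat \<Rightarrow> 'a chain"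
      by (induction I rule: infinite_finite_induct) (auto simp: h0 hadd)
    have "rainbow_count p L (h (p - Suc 0) (frag_of (singular_face p k s))) = 0" if "k \<le> p" for k
    proof (rule rainbow_count_missing_label[OF _ that])
      have "singular_simplex (p - Suc 0) X (singular_face p k s)"
        using s False that by (intro singular_simplex_singular_face) auto
      moreover have "L (singular_face p k s x) \<noteq> k" if "x \<in> standard_simplex (p - Suc 0)" for x
        using that False \<open>k \<le> p\<close> face[of "simplical_face k x" k] simplical_face_in_standard_simplex[of p k x]
        by (simp add: singular_face_def) (simp add: simplical_face_def)
      ultimately have "singular_chain (p - Suc 0) (subtopology X {x. L x \<noteq> k}) (frag_of (singular_face p k s))"
        by (auto simp: singular_chain_of singular_simplex_subtopology)
      then show "singular_chain p (subtopology X {x. L x \<noteq> k}) (h (p - Suc 0) (frag_of (singular_face p k s)))"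
        using hc[of "p - Suc 0"] False by simp
    qed
    then show ?thesis
      using False by (simp add: chain_boundary_of hsum hcmul rainbow_count_sum rainbow_count_cmul)
  qed (simp add: h0 chain_boundary_of)
  have "singular_chain p X (frag_of s)" using s by (simp add: singular_chain_of)
  from hb[OF this] have "(singular_subdivision p ^^ n) (frag_of s)
      = frag_of s + (chain_boundary (Suc p) (h p (frag_of s)) + h (p - Suc 0) (chain_boundary p (frag_of s)))"
    by simp
  then show ?thesis using 1 2 3 by (simp add: rainbow_count_add)
qed

text \<open>After sufficient subdivision each simplex of \<open>f\<close> lies in \<open>W\<close>,
  where no label exceeds \<open>p\<close>, or in some \<open>U i\<close>, where \<open>i\<close> is
  missing; each simplex of \<open>g\<close> lies in some \<open>U i\<close>. So \<open>2 e\<close>,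
  the boundary of \<open>f\<close>, \<open>g\<close> and \<open>c\<close> all have even counts,
  whereas the count of \<open>s\<close> stays odd. In the applications \<open>S\<close> is the
  complement of a point, \<open>g\<close> is the part of a relative boundary away from it, and
  \<open>c\<close> is a piece of the cycle on which one label is absent.\<close>

lemma sperner_obstruction:
  assumes U: "\<And>i. i \<le> p \<Longrightarrow> openin X (U i)" "\<And>i x. \<lbrakk>i \<le> p; x \<in> U i\<rbrakk> \<Longrightarrow> L x \<noteq> i"
    and W: "openin X W" "\<And>x. x \<in> W \<Longrightarrow> L x \<le> p"
    and covX: "topspace X \<subseteq> W \<union> (\<Union>i\<le>p. U i)"
    and covS: "topspace X \<inter> S \<subseteq> (\<Union>i\<le>p. U i)"
    and s: "singular_simplex p X s"
    and le: "\<And>x. x \<in> standard_simplex p \<Longrightarrow> L (s x) \<le> p"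
    and face: "\<And>x i. \<lbrakk>x \<in> standard_simplex p; i \<le> p; x i = 0\<rbrakk> \<Longrightarrow> L (s x) \<noteq> i"
    and f: "singular_chain (Suc p) X f"
    and g: "singular_chain p (subtopology X S) g"
    and c: "singular_chain p (subtopology X {x. L x \<noteq> j}) c" "j \<le> p"
  shows "frag_of s \<noteq> frag_cmul 2 e + chain_boundary (Suc p) f + g + c"
proof
  assume eq: "frag_of s = frag_cmul 2 e + chain_boundary (Suc p) f + g + c"
  obtain n1 where n1: "\<And>m t. \<lbrakk>n1 \<le> m; t \<in> Poly_Mapping.keys ((singular_subdivision (Suc p) ^^ m) f)\<rbrakk>
                      \<Longrightarrow> \<exists>V \<in> insert W (U ` {..p}). t \<in> (standard_simplex (Suc p)) \<rightarrow> V"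
    by (rule sufficient_iterated_singular_subdivision_exists[OF _ _ f, of "insert W (U ` {..p})"])
      (use U W covX in auto)
  obtain n2 where n2: "\<And>m t. \<lbrakk>n2 \<le> m; t \<in> Poly_Mapping.keys ((singular_subdivision p ^^ m) g)\<rbrakk>
                      \<Longrightarrow> \<exists>V \<in> (\<lambda>i. S \<inter> U i) ` {..p}. t \<in> (standard_simplex p) \<rightarrow> V"
    by (rule sufficient_iterated_singular_subdivision_exists[OF _ _ g, of "(\<lambda>i. S \<inter> U i) ` {..p}"])
      (use U covS in \<open>auto simp: openin_subtopology_Int2\<close>)
  define m where "m = max n1 n2"
  let ?sd = "singular_subdivision p ^^ m"
  have F: "even (rainbow_count p L (?sd (chain_boundary (Suc p) f)))"
  proof -
    have "even (rainbow_count p L (chain_boundary (Suc p) ((singular_subdivision (Suc p) ^^ m) f)))"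
    proof (rule even_rainbow_count_boundary)
      fix t assume "t \<in> Poly_Mapping.keys ((singular_subdivision (Suc p) ^^ m) f)"
      then obtain V where "V \<in> insert W (U ` {..p})" "t \<in> (standard_simplex (Suc p)) \<rightarrow> V"
        using n1[of m t] unfolding m_def by (meson max.cobounded1)
      then consider "t \<in> (standard_simplex (Suc p)) \<rightarrow> W"
        | i where "i \<le> p" "t \<in> (standard_simplex (Suc p)) \<rightarrow> U i" by auto
      then show "\<not> {..p} \<subset> vertex_labels (Suc p) L t"
      proof cases
        case 1
        then have "vertex_labels (Suc p) L t \<subseteq> {..p}"
          unfolding vertex_labels_def using W(2) simplex_vertex_in by (fastforce simp: Pi_iff)
        then show ?thesis by blast
      next
        case 2
        then have "i \<notin> vertex_labels (Suc p) L t"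
          unfolding vertex_labels_def using U(2) simplex_vertex_in by (fastforce simp: Pi_iff)
        then show ?thesis using 2 by auto
      qed
    qed
    then show ?thesis using chain_boundary_subdivision_power[OF f, of m] by simp
  qed
  have G: "rainbow_count p L (?sd g) = 0"
  proof (rule rainbow_count_eq_0)
    fix t assume "t \<in> Poly_Mapping.keys (?sd g)"
    then obtain V where "V \<in> (\<lambda>i. S \<inter> U i) ` {..p}" "t \<in> (standard_simplex p) \<rightarrow> V"
      using n2[of m t] unfolding m_def by (meson max.cobounded2)
    then obtain i where i: "i \<le> p" "t \<in> (standard_simplex p) \<rightarrow> S \<inter> U i"
      by auto
    then have "i \<notin> vertex_labels p L t"
      unfolding vertex_labels_def using U(2) simplex_vertex_in by (fastforce simp: Pi_iff)
    then show "vertex_labels p L t \<noteq> {..p}" using i by auto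
  qed
  have C: "rainbow_count p L (?sd c) = 0"
    using rainbow_count_missing_label singular_chain_subdivision_power c by blast
  \<comment> \<open>Nothing is assumed about \<open>e\<close>; additivity of the subdivision alone
    makes this term even.\<close>
  have E: "?sd (frag_cmul 2 e) = frag_cmul 2 (?sd e)"
    using singular_subdivision_power_add[of m p e e] frag_cmul_distrib[of 1 1 e] frag_cmul_distrib[of 1 1 "?sd e"]
    by simp
  have "even (rainbow_count p L (?sd (frag_of s)))"
    unfolding eq singular_subdivision_power_add rainbow_count_add E G C
    using F by (simp add: rainbow_count_cmul)
  moreover have "odd (rainbow_count p L (?sd (frag_of s)))"
    using odd_rainbow_count_subdivision[of p X s L m] s le face by auto
  ultimately show False by blast
qed

section \<open>Geometric realizations\<close>

lemma realization_iff:
  "t \<in> topspace (geometric_realization K) \<longleftrightarrow>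
     (\<forall>v. 0 \<le> t v) \<and> {v. t v \<noteq> 0} \<in> K \<and> (\<Sum>v | t v \<noteq> 0. t v) = 1"
  by (simp add: geometric_realization_def)

lemma
  assumes "t \<in> topspace (geometric_realization K)"
  shows realization_nonneg: "0 \<le> t v"
    and realization_support: "{v. t v \<noteq> 0} \<in> K"
    and realization_finite_support: "finite {v. t v \<noteq> 0}"
proof -
  have t: "(\<forall>v. 0 \<le> t v) \<and> {v. t v \<noteq> 0} \<in> K \<and> (\<Sum>v | t v \<noteq> 0. t v) = 1"
    using assms by (simp add: realization_iff)
  then show "0 \<le> t v" "{v. t v \<noteq> 0} \<in> K" by auto
  show "finite {v. t v \<noteq> 0}"
  proof (rule ccontr)
    assume "infinite {v. t v \<noteq> 0}"
    \<comment> \<open>Over an infinite index set \<open>sum\<close> has the default value 0, so the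
      condition that the coordinates sum to 1 also enforces finite support.\<close>
    then have "(\<Sum>v | t v \<noteq> 0. t v) = 0" by (rule sum.infinite)
    with t show False by simp
  qed
qed

lemma realization_sum_eq_1:
  assumes "t \<in> topspace (geometric_realization K)" "finite A" "{v. t v \<noteq> 0} \<subseteq> A"
  shows "sum t A = 1"
proof -
  have "sum t A = (\<Sum>v | t v \<noteq> 0. t v)"
    using assms by (intro sum.mono_neutral_right) auto
  then show ?thesis using assms(1) by (simp add: realization_iff)
qed

lemma realization_sum_le_1:
  assumes "t \<in> topspace (geometric_realization K)" "finite A"
  shows "sum t A \<le> 1"
proof -
  have "sum t A \<le> sum t (A \<union> {v. t v \<noteq> 0})"
    using assms realization_nonneg[OF assms(1)] realization_finite_support[OF assms(1)]
    by (intro sum_mono2) auto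
  also have "\<dots> = 1"
    using assms realization_finite_support[OF assms(1)] by (intro realization_sum_eq_1) auto
  finally show ?thesis .
qed

lemma realizationI:
  assumes "\<And>v. 0 \<le> t v" "{v. t v \<noteq> 0} \<in> K" "finite A" "{v. t v \<noteq> 0} \<subseteq> A" "sum t A = 1"
  shows "t \<in> topspace (geometric_realization K)"
proof -
  have "sum t A = (\<Sum>v | t v \<noteq> 0. t v)"
    using assms by (intro sum.mono_neutral_right) auto
  then show ?thesis using assms by (simp add: realization_iff)
qed

lemma continuous_map_coordinate [continuous_intros]:
  "continuous_map (geometric_realization K) euclideanreal (\<lambda>t. t v)"
  unfolding geometric_realization_def
  by (intro continuous_map_from_subtopology continuous_map_product_projection) auto

lemma continuous_map_into_realization:
  assumes "\<And>v. continuous_map Y euclideanreal (\<lambda>y. f y v)"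
    and "\<And>y. y \<in> topspace Y \<Longrightarrow> f y \<in> topspace (geometric_realization K)"
  shows "continuous_map Y (geometric_realization K) f"
  using assms unfolding geometric_realization_def
  by (auto simp: continuous_map_in_subtopology continuous_map_componentwise_UNIV)

lemma openin_realization_less:
  assumes "continuous_map X euclideanreal f" "continuous_map X euclideanreal g"
  shows "openin X {t \<in> topspace X. f t < g t}"
proof -
  have "continuous_map X euclideanreal (\<lambda>t. g t - f t)"
    using assms by (intro continuous_map_diff)
  from openin_continuous_map_preimage[OF this, of "{0<..}"] show ?thesis
    by (simp add: open_openin[symmetric])
qed

lemma realization_mono:
  "K \<subseteq> K' \<Longrightarrow> topspace (geometric_realization K) \<subseteq> topspace (geometric_realization K')"
  by (auto simp: realization_iff)

lemma realization_subtopology: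
  "K \<subseteq> K' \<Longrightarrow> geometric_realization K =
     subtopology (geometric_realization K') (topspace (geometric_realization K))"
  using realization_mono[of K K']
  by (simp add: geometric_realization_def subtopology_subtopology Int_absorb1)

section \<open>Barycentres and affine simplices in a realization\<close>

definition barycentre :: "'a set \<Rightarrow> 'a \<Rightarrow> real" where
  "barycentre A = (\<lambda>a. if a \<in> A then 1 / real (card A) else 0)"

lemma barycentre_in_realization:
  assumes "A \<in> K" "finite A" "A \<noteq> {}"
  shows "barycentre A \<in> topspace (geometric_realization K)"
proof -
  have "{v. barycentre A v \<noteq> 0} = A" using assms by (auto simp: barycentre_def)
  moreover have "sum (barycentre A) A = 1" using assms by (simp add: barycentre_def)
  ultimately show ?thesis
    using assms by (intro realizationI[where A=A]) (auto simp: barycentre_def)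
qed

text \<open>The coordinates sum to 1, so lower bounds that already sum to 1 are equalities.
  Contrapositively, at every other point some coordinate on \<open>A\<close> is below
  \<open>1 / card A\<close>; open conditions of this kind cover the punctured realization.\<close>

lemma eq_barycentre:
  assumes t: "t \<in> topspace (geometric_realization K)"
    and A: "finite A" "A \<noteq> {}" "\<And>a. a \<in> A \<Longrightarrow> 1 / real (card A) \<le> t a"
  shows "t = barycentre A"
proof
  fix b
  have 1: "(\<Sum>a\<in>A. 1 / real (card A)) = 1" using A by simp
  have 2: "sum t A \<le> 1" using realization_sum_le_1[OF t A(1)] .
  have 3: "(\<Sum>a\<in>A. 1 / real (card A)) \<le> sum t A" by (rule sum_mono) (rule A(3))
  show "t b = barycentre A b"
  proof (cases "b \<in> A")
    case True
    have "sum t A = (\<Sum>a\<in>A. 1 / real (card A))"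
      using 1 2 3 by linarith
    then have "(\<Sum>a\<in>A. t a - 1 / real (card A)) = 0" by (simp add: sum_subtractf)
    then have "t b - 1 / real (card A) = 0"
      using sum_nonneg_0[OF A(1), of "\<lambda>a. t a - 1 / real (card A)" b] A(3) True by auto
    then show ?thesis using True by (simp add: barycentre_def)
  next
    case False
    have "sum t (insert b A) \<le> 1" using realization_sum_le_1[OF t] A(1) by simp
    then have "t b + sum t A \<le> 1" using False A(1) by simp
    moreover have "1 \<le> sum t A"
      using 1 3 by linarith
    ultimately show ?thesis using False realization_nonneg[OF t, of b] by (simp add: barycentre_def)
  qed
qed

text \<open>\<open>simplex_vertex\<close> plays two roles: on indices it is a vertex of the standard
  simplex, on vertices of a complex it is a point of the realization. This is the affine simplex
  that sends the former to the latter in the order given by \<open>v\<close>.\<close>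

definition vertex_simplex :: "nat \<Rightarrow> (nat \<Rightarrow> 'a) \<Rightarrow> (nat \<Rightarrow> real) \<Rightarrow> 'a \<Rightarrow> real" where
  "vertex_simplex p v = oriented_simplex p (\<lambda>j. simplex_vertex (v j))"

lemma vertex_simplex_apply:
  assumes "x \<in> standard_simplex p" "inj_on v {..p}" "j \<le> p"
  shows "vertex_simplex p v x (v j) = x j"
proof -
  have "(\<Sum>i\<le>p. simplex_vertex (v i) (v j) * x i) = (\<Sum>i\<le>p. if i = j then x i else 0)"
    using assms by (intro sum.cong) (auto simp: simplex_vertex_def inj_on_eq_iff)
  then show ?thesis using assms by (simp add: vertex_simplex_def oriented_simplex_def)
qed

lemma vertex_simplex_outside:
  assumes "x \<in> standard_simplex p" "a \<notin> v ` {..p}"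
  shows "vertex_simplex p v x a = 0"
proof -
  have "(\<Sum>i\<le>p. simplex_vertex (v i) a * x i) = 0"
    using assms by (intro sum.neutral) (auto simp: simplex_vertex_def)
  then show ?thesis using assms by (simp add: vertex_simplex_def oriented_simplex_def)
qed

lemma vertex_simplex_in_realization:
  assumes x: "x \<in> standard_simplex p" and v: "inj_on v {..p}"
    and K: "\<And>B. \<lbrakk>B \<subseteq> v ` {..p}; B \<noteq> {}\<rbrakk> \<Longrightarrow> B \<in> K"
  shows "vertex_simplex p v x \<in> topspace (geometric_realization K)"
proof (rule realizationI)
  let ?t = "vertex_simplex p v x"
  show "0 \<le> ?t a" for a
    using x v vertex_simplex_apply[OF x v] vertex_simplex_outside[OF x, of a v]
    by (cases "a \<in> v ` {..p}") (auto simp: standard_simplex_def)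
  show s: "{a. ?t a \<noteq> 0} \<subseteq> v ` {..p}"
    using vertex_simplex_outside[OF x] by fastforce
  have "sum ?t (v ` {..p}) = (\<Sum>j\<le>p. x j)"
    using v vertex_simplex_apply[OF x v] by (subst sum.reindex) auto
  then show 1: "sum ?t (v ` {..p}) = 1" using x by (simp add: standard_simplex_def)
  then have "{a. ?t a \<noteq> 0} \<noteq> {}"
    using sum.neutral[of "v ` {..p}" ?t] by fastforce
  then show "{a. ?t a \<noteq> 0} \<in> K" using s K by blast
qed auto

lemma singular_simplex_vertex_simplex:
  assumes v: "inj_on v {..p}" and K: "\<And>B. \<lbrakk>B \<subseteq> v ` {..p}; B \<noteq> {}\<rbrakk> \<Longrightarrow> B \<in> K"
  shows "singular_simplex p (geometric_realization K) (vertex_simplex p v)"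
proof -
  have "simplicial_simplex p (topspace (geometric_realization K)) (vertex_simplex p v)"
    using vertex_simplex_in_realization[OF _ v K]
    by (auto simp: simplicial_simplex vertex_simplex_def)
  then show ?thesis
    using simplicial_imp_singular_simplex
    by (fastforce simp: geometric_realization_def)
qed

lemma singular_face_vertex_simplex:
  assumes "k \<le> Suc p"
  shows "singular_face (Suc p) k (vertex_simplex (Suc p) v) =
         vertex_simplex p (v \<circ> skip k)"
  using assms unfolding vertex_simplex_def
  by (subst singular_face_oriented_simplex) (auto simp: if_distrib skip_def)

text \<open>The coordinate of a vertex of \<open>A\<close> that the simplex lacks vanishes on the
  simplex but not at the barycentre. Such simplices can be discarded in homology relative to the
  complement of the barycentre.\<close>

lemma vertex_simplex_avoids_barycentre:
  assumes v: "inj_on v {..p}" and K: "\<And>B. \<lbrakk>B \<subseteq> v ` {..p}; B \<noteq> {}\<rbrakk> \<Longrightarrow> B \<in> K"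
    and A: "finite A" "\<not> A \<subseteq> v ` {..p}"
  shows "singular_chain p (subtopology (geometric_realization K)
           (topspace (geometric_realization K) - {barycentre A})) (frag_of (vertex_simplex p v))"
proof -
  let ?X = "geometric_realization K"
  have ss: "singular_simplex p ?X (vertex_simplex p v)"
    using v K by (rule singular_simplex_vertex_simplex)
  obtain a where a: "a \<in> A" "a \<notin> v ` {..p}" using A by blast
  have "barycentre A a \<noteq> 0" using a A by (auto simp: barycentre_def)
  then have "vertex_simplex p v x \<noteq> barycentre A" if "x \<in> standard_simplex p" for x
    using vertex_simplex_outside[OF that a(2)] by auto
  moreover have "vertex_simplex p v x \<in> topspace ?X" if "x \<in> standard_simplex p" for x
    using ss that by (auto simp: singular_simplex_def continuous_map_def)
  ultimately show ?thesis
    using ss by (auto simp: singular_chain_of singular_simplex_subtopology)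
qed

text \<open>A point is labelled by a vertex of the simplex at which its coordinate is at least that
  of the barycentre, and by \<open>Suc p\<close> if there is none. Maximality keeps the label
  \<open>Suc p\<close> away from the barycentre: where all coordinates of the simplex are positive,
  the support is exactly its vertex set, so the point lies in the simplex.\<close>

lemma maximal_simplex_obstruction:
  assumes v: "inj_on v {..p}" and K: "\<And>B. \<lbrakk>B \<subseteq> v ` {..p}; B \<noteq> {}\<rbrakk> \<Longrightarrow> B \<in> K"
    and max: "\<And>B. \<lbrakk>B \<in> K; v ` {..p} \<subseteq> B\<rbrakk> \<Longrightarrow> B = v ` {..p}"
    and f: "singular_chain (Suc p) (geometric_realization K) f"
    and g: "singular_chain p (subtopology (geometric_realization K)
              (topspace (geometric_realization K) - {barycentre (v ` {..p})})) g"
  shows "frag_of (vertex_simplex p v) \<noteq> frag_cmul 2 e + chain_boundary (Suc p) f + g"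
proof -
  let ?X = "geometric_realization K"
  \<comment> \<open>The common coordinate of the barycentre of \<open>p + 1\<close> vertices. It is
    also the average of the coordinates of any point of the simplex, so at least one of them reaches
    it.\<close>
  define a where "a = 1 / (1 + real p)"
  have a: "a > 0" by (simp add: a_def)
  have card: "card (v ` {..p}) = Suc p" using v by (simp add: card_image)
  define L where "L t = (if \<exists>i\<le>p. a \<le> t (v i) then SOME i. i \<le> p \<and> a \<le> t (v i) else Suc p)" for t
  have L: "a \<le> t (v (L t))" if "L t \<le> p" for t
    using that someI_ex[of "\<lambda>i. i \<le> p \<and> a \<le> t (v i)"] unfolding L_def by (auto split: if_splits)
  have L_le: "L t \<le> p" if "\<exists>i\<le>p. a \<le> t (v i)" for t
    using that someI_ex[of "\<lambda>i. i \<le> p \<and> a \<le> t (v i)"] unfolding L_def by auto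
  have ex: "\<exists>i\<le>p. a \<le> t (v i)" if "sum t (v ` {..p}) = 1" for t
  proof (rule ccontr)
    assume "\<not> ?thesis"
    then have "(\<Sum>i\<le>p. t (v i)) < (\<Sum>i\<le>p. a)"
      by (intro sum_strict_mono) auto
    then show False using that v by (simp add: sum.reindex a_def)
  qed
  define U where "U i = {t \<in> topspace ?X. t (v i) < a}" for i
  \<comment> \<open>The threshold \<open>a / 2\<close> makes the coordinates positive and the set
    open; being below \<open>a\<close>, it lets \<open>W\<close> and the sets \<open>U i\<close>
    cover the whole space.\<close>
  define W where "W = {t \<in> topspace ?X. \<forall>i\<in>{..p}. a / 2 < t (v i)}"
  have W: "W = (\<Inter>i\<le>p. {t \<in> topspace ?X. a / 2 < t (v i)}) \<inter> topspace ?X"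
    by (auto simp: W_def)
  \<comment> \<open>No extra piece of a cycle is split off here: the last summand is the zero chain,
    which avoids label 0 trivially.\<close>
  have "frag_of (vertex_simplex p v) \<noteq> frag_cmul 2 e + chain_boundary (Suc p) f + g + 0"
  proof (rule sperner_obstruction[where L=L and U=U and W=W and j=0, OF _ _ _ _ _ _ _ _ _ f g])
    show "openin ?X (U i)" for i
      unfolding U_def by (intro openin_realization_less continuous_intros) auto
    show "openin ?X W"
      unfolding W by (intro openin_INT openin_realization_less continuous_intros) auto
    show "L t \<noteq> i" if "i \<le> p" "t \<in> U i" for i t
      using that L[of t] by (auto simp: U_def)
    show "L t \<le> p" if "t \<in> W" for t
    proof -
      have t: "t \<in> topspace ?X" using that by (simp add: W_def)
      have "v ` {..p} \<subseteq> {v. t v \<noteq> 0}" using that a by (force simp: W_def)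
      with max[OF realization_support[OF t]] have "{v. t v \<noteq> 0} = v ` {..p}" by blast
      then show ?thesis using ex realization_sum_eq_1[OF t] L_le by simp
    qed
    show "topspace ?X \<subseteq> W \<union> (\<Union>i\<le>p. U i)"
    proof
      fix t assume t: "t \<in> topspace ?X"
      show "t \<in> W \<union> (\<Union>i\<le>p. U i)"
      proof (cases "\<exists>i\<le>p. t (v i) < a")
        case False
        then have "a / 2 < t (v i)" if "i \<le> p" for i using that a by (force simp: not_less)
        then show ?thesis using t by (auto simp: W_def)
      qed (use t in \<open>auto simp: U_def\<close>)
    qed
    show "topspace ?X \<inter> (topspace ?X - {barycentre (v ` {..p})}) \<subseteq> (\<Union>i\<le>p. U i)"
    proof
      fix t assume "t \<in> topspace ?X \<inter> (topspace ?X - {barycentre (v ` {..p})})"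
      then have t: "t \<in> topspace ?X" "t \<noteq> barycentre (v ` {..p})" by auto
      have "\<exists>i\<le>p. t (v i) < a"
      proof (rule ccontr)
        assume "\<not> ?thesis"
        then have "t = barycentre (v ` {..p})"
          by (intro eq_barycentre[OF t(1)]) (auto simp: card a_def not_less)
        then show False using t by simp
      qed
      then show "t \<in> (\<Union>i\<le>p. U i)" using t by (auto simp: U_def)
    qed
    show "singular_simplex p ?X (vertex_simplex p v)"
      using v K by (rule singular_simplex_vertex_simplex)
    show "L (vertex_simplex p v x) \<le> p" if "x \<in> standard_simplex p" for x
    proof (rule L_le, rule ex)
      have "sum (vertex_simplex p v x) (v ` {..p}) = (\<Sum>j\<le>p. x j)"
        using v vertex_simplex_apply[OF that v] by (subst sum.reindex) auto
      then show "sum (vertex_simplex p v x) (v ` {..p}) = 1" using that by (simp add: standard_simplex_def)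
    qed
    show "L (vertex_simplex p v x) \<noteq> i" if "x \<in> standard_simplex p" "i \<le> p" "x i = 0" for x i
      using that L[of "vertex_simplex p v x"] vertex_simplex_apply[OF that(1) v that(2)] a by auto
  qed auto
  then show ?thesis by simp
qed

section \<open>Local homology of books\<close>

abbreviation local_homology_group :: "int \<Rightarrow> 'a topology \<Rightarrow> 'a \<Rightarrow> 'a chain set monoid" where
  "local_homology_group i X x \<equiv> relative_homology_group i X (topspace X - {x})"

lemma relboundary_if_trivial:
  assumes "trivial_group (relative_homology_group (int p) X S)" "singular_relcycle p X S c"
  shows "singular_relboundary p X S c"
proof -
  have "homologous_rel_set p X S c \<in> carrier (relative_homology_group (int p) X S)"
    using assms(2) by (simp add: carrier_relative_homology_group)
  then have "homologous_rel_set p X S c = singular_relboundary_set p X S"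
    using assms(1) by (simp add: trivial_group_def)
  then show ?thesis by (simp add: homologous_rel_set_eq_relboundary)
qed

text \<open>The identity is homotopic, as a map of pairs, to a map that factors through the pair
  \<open>(S, S)\<close>, whose homology vanishes.\<close>

lemma trivial_relative_homology_group_if_deformable:
  assumes h: "homotopic_with (\<lambda>h. h \<in> S \<rightarrow> S) X X id f"
    and f: "f ` topspace X \<subseteq> S" "S \<subseteq> topspace X"
  shows "trivial_group (relative_homology_group i X S)"
proof -
  let ?H = "relative_homology_group i X S"
  let ?Y = "subtopology X S"
  have Y: "topspace ?Y = S" using f by auto
  have fc: "continuous_map X ?Y f"
    using homotopic_with_imp_continuous_maps[OF h] f by (auto simp: continuous_map_in_subtopology)
  have T: "trivial_group (relative_homology_group i ?Y S)"
    using trivial_relative_homology_group_topspace[of i ?Y] Y by simp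
  have "c = \<one>\<^bsub>?H\<^esub>" if c: "c \<in> carrier ?H" for c
  proof -
    have "c = hom_induced i X S X S id c" using hom_induced_id[OF c] by simp
    also have "\<dots> = hom_induced i X S X S (id \<circ> f) c"
      using homology_homotopy_axiom[OF h] by simp
    also have "\<dots> = hom_induced i ?Y S X S id (hom_induced i X S ?Y S f c)"
      using fc f by (subst hom_induced_compose[of X ?Y f S S X id S])
        (auto simp: continuous_map_from_subtopology)
    also have "hom_induced i X S ?Y S f c = \<one>\<^bsub>relative_homology_group i ?Y S\<^esub>"
      using hom_induced_carrier[of i X S ?Y S f c] T by (simp add: trivial_group_def)
    also have "hom_induced i ?Y S X S id \<dots> = \<one>\<^bsub>?H\<^esub>"
      by (rule hom_one[OF hom_induced_hom]) auto
    finally show ?thesis .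
  qed
  moreover have "\<one>\<^bsub>?H\<^esub> \<in> carrier ?H" by (simp add: group.is_monoid monoid.one_closed)
  ultimately have "carrier ?H = {\<one>\<^bsub>?H\<^esub>}" by blast
  then show ?thesis by (simp only: trivial_group_def group_relative_homology_group simp_thms)
qed

text \<open>Any two nonzero integers have a nonzero common multiple, whereas the images of
  \<open>A\<close> and \<open>B\<close> in \<open>G\<close> meet trivially: \<open>F\<close> kills
  the second and is injective on the first.\<close>

lemma not_iso_integer_group_if_two_summands:
  assumes G: "group A" "group B" "group G"
    and i: "i \<in> hom A G" "F \<in> hom G A" "\<And>x. x \<in> carrier A \<Longrightarrow> F (i x) = x"
    and j: "j \<in> hom B G" "F' \<in> hom G B" "\<And>y. y \<in> carrier B \<Longrightarrow> F' (j y) = y"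
    and 0: "\<And>y. y \<in> carrier B \<Longrightarrow> F (j y) = \<one>\<^bsub>A\<^esub>"
    and nt: "\<not> trivial_group A" "\<not> trivial_group B"
  shows "\<not> G \<cong> integer_group"
proof
  assume "G \<cong> integer_group"
  then obtain \<phi> where \<phi>: "\<phi> \<in> iso G integer_group" by (auto simp: is_iso_def)
  then have \<phi>h: "\<phi> \<in> hom G integer_group" and \<phi>i: "inj_on \<phi> (carrier G)"
    by (auto simp: iso_def bij_betw_def)
  interpret A: group A by fact
  interpret B: group B by fact
  interpret G: group G by fact
  obtain x where x: "x \<in> carrier A" "x \<noteq> \<one>\<^bsub>A\<^esub>"
    using nt(1) G(1) A.one_closed unfolding trivial_group_def by blast
  obtain y where y: "y \<in> carrier B" "y \<noteq> \<one>\<^bsub>B\<^esub>"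
    using nt(2) G(2) B.one_closed unfolding trivial_group_def by blast
  have c: "i x \<in> carrier G" "j y \<in> carrier G"
    using i j x y by (auto simp: hom_def)
  have one: "\<phi> \<one>\<^bsub>G\<^esub> = 0" using hom_one[OF \<phi>h G(3)] by simp
  have z: "g = \<one>\<^bsub>G\<^esub>" if "g \<in> carrier G" "\<phi> g = 0" for g
    using inj_onD[OF \<phi>i, of g "\<one>\<^bsub>G\<^esub>"] that one by simp
  have pow: "\<phi> (g [^]\<^bsub>G\<^esub> k) = k * \<phi> g" if "g \<in> carrier G" for g and k :: int
    using hom_int_pow[OF \<phi>h that G(3)] by simp
  have yn: "\<phi> (j y) \<noteq> 0"
    using z[OF c(2)] y j(3)[OF y(1)] hom_one[OF j(2) G(3,2)] by auto
  \<comment> \<open>Under \<open>\<phi>\<close> both sides become the product of the integers that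
    represent \<open>i x\<close> and \<open>j y\<close>. Applying \<open>F\<close> then kills the
    right-hand side.\<close>
  have "i x [^]\<^bsub>G\<^esub> (\<phi> (j y)) = j y [^]\<^bsub>G\<^esub> (\<phi> (i x))"
    using c by (intro inj_onD[OF \<phi>i]) (auto simp: pow)
  then have "F (i x) [^]\<^bsub>A\<^esub> (\<phi> (j y)) = F (j y) [^]\<^bsub>A\<^esub> (\<phi> (i x))"
    using hom_int_pow[OF i(2) c(1) G(3,1)] hom_int_pow[OF i(2) c(2) G(3,1)] by metis
  then have "x [^]\<^bsub>A\<^esub> (\<phi> (j y)) = \<one>\<^bsub>A\<^esub>"
    using i(3) x 0 y by (simp add: A.int_pow_one)
  then have "i x [^]\<^bsub>G\<^esub> (\<phi> (j y)) = \<one>\<^bsub>G\<^esub>"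
    using hom_int_pow[OF i(1) x(1) G(1,3)] hom_one[OF i(1) G(1,3)] by metis
  then have "\<phi> (j y) * \<phi> (i x) = 0" using pow[OF c(1)] one by metis
  then have "i x = \<one>\<^bsub>G\<^esub>" using yn z c by auto
  then show False using i(3)[OF x(1)] x(2) hom_one[OF i(2) G(3,1)] by simp
qed

text \<open>The star of a ridge: the simplices with vertex sets \<open>insert w \<rho>\<close>, the pages, are glued along \<open>\<rho>\<close>.\<close>

definition book :: "'a set \<Rightarrow> 'a set \<Rightarrow> 'a set set" where
  "book \<rho> W = {B. B \<noteq> {} \<and> (\<exists>w\<in>W. B \<subseteq> insert w \<rho>)}"

lemma book_mono: "V \<subseteq> W \<Longrightarrow> book \<rho> V \<subseteq> book \<rho> W"
  by (auto simp: book_def)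

lemma book_realizationI:
  assumes "\<And>v. 0 \<le> t v" "w \<in> W" "{v. t v \<noteq> 0} \<subseteq> insert w \<rho>" "finite \<rho>" "sum t (insert w \<rho>) = 1"
  shows "t \<in> topspace (geometric_realization (book \<rho> W))"
proof (rule realizationI)
  have "{v. t v \<noteq> 0} \<noteq> {}"
    using assms(5) sum.neutral[of "insert w \<rho>" t] by fastforce
  then show "{v. t v \<noteq> 0} \<in> book \<rho> W" using assms by (auto simp: book_def)
qed (use assms in auto)

lemma book_realizationE:
  assumes "t \<in> topspace (geometric_realization (book \<rho> W))" "finite \<rho>"
  obtains w where "w \<in> W" "{v. t v \<noteq> 0} \<subseteq> insert w \<rho>" "sum t (insert w \<rho>) = 1"
proof -
  obtain w where "w \<in> W" "{v. t v \<noteq> 0} \<subseteq> insert w \<rho>"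
    using realization_support[OF assms(1)] by (auto simp: book_def)
  moreover have "sum t (insert w \<rho>) = 1"
    by (rule realization_sum_eq_1[OF assms(1)]) (use assms calculation in auto)
  ultimately show thesis using that by blast
qed

text \<open>The page is a simplex with \<rho> as a proper face. Moving along segments to the
  barycentre of the page makes the coordinate at \<open>w\<close> positive at once, while it is zero
  at the barycentre of \<rho>; so the deformation respects the complement of that point and ends
  inside it.\<close>

lemma local_homology_one_page:
  assumes \<rho>: "finite \<rho>" "\<rho> \<noteq> {}" "w \<notin> \<rho>"
  shows "trivial_group (local_homology_group i (geometric_realization (book \<rho> {w})) (barycentre \<rho>))"
proof -
  let ?X = "geometric_realization (book \<rho> {w})" and ?A = "insert w \<rho>"
  let ?S = "topspace ?X - {barycentre \<rho>}"
  let ?q = "barycentre ?A"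
  define h where "h = (\<lambda>(s::real, t) v. (1 - s) * t v + s * ?q v)"
  have q: "?q \<in> topspace ?X"
    using \<rho> by (intro barycentre_in_realization) (auto simp: book_def)
  have qw: "?q w > 0" using \<rho> by (simp add: barycentre_def card_gt_0_iff)
  have hin: "h (s, t) \<in> topspace ?X" if s: "0 \<le> s" "s \<le> 1" and t: "t \<in> topspace ?X" for s t
  proof -
    from t \<rho>(1) have t': "{v. t v \<noteq> 0} \<subseteq> ?A" "sum t ?A = 1"
      by (auto elim!: book_realizationE)
    from q \<rho>(1) have q': "{v. ?q v \<noteq> 0} \<subseteq> ?A" "sum ?q ?A = 1"
      by (auto elim!: book_realizationE)
    show ?thesis
    proof (rule book_realizationI)
      show "0 \<le> h (s, t) v" for v
        using s realization_nonneg[OF t] realization_nonneg[OF q] by (simp add: h_def)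
      have "h (s, t) v = 0" if "v \<notin> ?A" for v
      proof -
        have "t v = 0" "?q v = 0" using that t'(1) q'(1) by blast+
        then show ?thesis by (simp add: h_def)
      qed
      then show "{v. h (s, t) v \<noteq> 0} \<subseteq> ?A" by blast
      have "sum (h (s, t)) ?A = (1 - s) * sum t ?A + s * sum ?q ?A"
        by (simp only: h_def sum.distrib sum_distrib_left prod.case)
      then show "sum (h (s, t)) ?A = 1" using t' q' by simp
    qed (use \<rho> in auto)
  qed
  have hS: "h (s, t) \<noteq> barycentre \<rho>" if s: "0 \<le> s" "s \<le> 1" and t: "t \<in> ?S" for s t
  proof (cases "s = 0")
    case True
    then show ?thesis using t by (simp add: h_def)
  next
    case False
    then have "h (s, t) w > 0"
      using s t qw realization_nonneg[of t "book \<rho> {w}" w] by (simp add: h_def add_nonneg_pos)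
    moreover have "barycentre \<rho> w = 0" using \<rho> by (simp add: barycentre_def)
    ultimately show ?thesis by auto
  qed
  have "homotopic_with (\<lambda>h. h \<in> ?S \<rightarrow> ?S) ?X ?X id (\<lambda>t. ?q)"
    unfolding homotopic_with_def
  proof (intro exI[of _ h] conjI allI ballI)
    show "continuous_map (prod_topology (top_of_set {0..1}) ?X) ?X h"
    proof (rule continuous_map_into_realization)
      show "continuous_map (prod_topology (top_of_set {0..1}) ?X) euclideanreal (\<lambda>y. h y v)" for v
      proof -
        have 1: "continuous_map (prod_topology (top_of_set {0..1}) ?X) euclideanreal fst"
          using continuous_map_into_fulltopology[OF continuous_map_fst] by blast
        have 2: "continuous_map (prod_topology (top_of_set {0..1}) ?X) euclideanreal (\<lambda>y. snd y v)"
          using continuous_map_compose[OF continuous_map_snd continuous_map_coordinate, of "top_of_set {0..1}" "book \<rho> {w}" v]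
          by (simp add: o_def)
        have "(\<lambda>y. h y v) = (\<lambda>y. (1 - fst y) * snd y v + fst y * ?q v)"
          by (auto simp: h_def fun_eq_iff)
        then show ?thesis using 1 2
          by (auto intro!: continuous_map_add continuous_map_real_mult continuous_map_diff)
      qed
    qed (use hin in auto)
    show "(\<lambda>x. h (s, x)) \<in> ?S \<rightarrow> ?S" if "s \<in> {0..1}" for s
      using that hin hS by auto
  qed (auto simp: h_def)
  moreover have "?q \<in> ?S" using q qw \<rho>(3) by (auto simp: barycentre_def fun_eq_iff)
  ultimately show ?thesis
    by (intro trivial_relative_homology_group_if_deformable) auto
qed

lemma vertex_simplex_cong:
  "(\<And>j. j \<le> p \<Longrightarrow> v j = v' j) \<Longrightarrow> vertex_simplex p v = vertex_simplex p v'"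
  by (simp add: vertex_simplex_def oriented_simplex_eq)

text \<open>The relative cycle is the difference of the two pages: the faces opposite to
  \<open>a\<close> and \<open>b\<close> cancel, and every other face misses a vertex of \<rho>. The
  functions \<open>t (u j) - \<delta>\<close> for \<open>1 \<le> j\<close>, together with
  \<open>t a - t b\<close>, vanish simultaneously only at the barycentre, and the labelling is made
  from their signs. The label \<open>Suc n\<close> does not occur on page \<open>b\<close>, which
  therefore can be the extra chain in the obstruction.\<close>

lemma local_homology_two_pages:
  assumes \<rho>: "finite \<rho>" "\<rho> \<noteq> {}" "a \<notin> \<rho>" "b \<notin> \<rho>" "a \<noteq> b"
  shows "\<not> trivial_group (local_homology_group (int (card \<rho>))
           (geometric_realization (book \<rho> {a, b})) (barycentre \<rho>))"
proof
  let ?X = "geometric_realization (book \<rho> {a, b})" and ?p = "barycentre \<rho>"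
  let ?S = "topspace ?X - {?p}"
  assume triv: "trivial_group (local_homology_group (int (card \<rho>)) ?X ?p)"
  obtain n where n: "card \<rho> = Suc n" using \<rho> by (cases "card \<rho>") auto
  obtain u where "bij_betw u {..<Suc n} \<rho>"
    using \<rho>(1) n by (metis finite_same_card_bij card_lessThan finite_lessThan)
  then have u: "bij_betw u {..n} \<rho>" by (simp add: lessThan_Suc_atMost)
  \<comment> \<open>The vertex off \<rho> gets the last index \<open>Suc n\<close>, so that the two
    pages have the same last face.\<close>
  define v where "v w j = (if j \<le> n then u j else w)" for w :: 'a and j
  have vim: "v w ` {..Suc n} = insert w \<rho>" for w
    using u by (auto simp: v_def bij_betw_def atMost_Suc)
  have vinj: "inj_on (v w) {..Suc n}" if "w \<notin> \<rho>" for w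
    using u that by (auto simp: v_def bij_betw_def inj_on_def)
  have u\<rho>: "u j \<in> \<rho>" if "j \<le> n" for j using u that by (auto simp: bij_betw_def)
  have sums: "sum t \<rho> = (\<Sum>j\<le>n. t (u j))" for t :: "'a \<Rightarrow> real"
    using sum.reindex_bij_betw[OF u, of t] by simp
  let ?s = "\<lambda>w. vertex_simplex (Suc n) (v w)"
  have ss: "singular_simplex (Suc n) ?X (?s w)" if "w \<in> {a, b}" for w
    using that \<rho> by (intro singular_simplex_vertex_simplex vinj) (auto simp: vim book_def)
  let ?c = "frag_of (?s a) - frag_of (?s b)"
  have fch: "singular_chain n (subtopology ?X ?S) (frag_of (singular_face (Suc n) k (?s w)))"
    if k: "k \<le> n" and w: "w \<in> {a, b}" for k w
  proof -
    have w: "w \<notin> \<rho>" using w \<rho> by auto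
    have k': "k \<le> Suc n" using k by simp
    have im: "(v w \<circ> skip k) ` {..n} = v w ` ({..Suc n} - {k})"
      unfolding image_comp[symmetric] image_skip[OF k'] ..
    have "v w k \<notin> v w ` ({..Suc n} - {k})"
      using vinj[OF w] k' by (simp add: inj_on_image_mem_iff)
    then have "\<not> \<rho> \<subseteq> (v w \<circ> skip k) ` {..n}"
      unfolding im using u\<rho>[OF k] k by (auto simp: v_def)
    moreover have "inj_on (v w \<circ> skip k) {..n}"
      using vinj[OF w] by (intro comp_inj_on inj_skip) (auto simp: image_skip[OF k'] intro: inj_on_subset)
    moreover have "B \<in> book \<rho> {a, b}" if "B \<subseteq> (v w \<circ> skip k) ` {..n}" "B \<noteq> {}" for B
    proof -
      have "B \<subseteq> insert w \<rho>" using that(1) unfolding im vim[of w, symmetric] by blast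
      then show ?thesis using \<open>w \<in> {a, b}\<close> that(2) unfolding book_def by blast
    qed
    ultimately show ?thesis
      unfolding singular_face_vertex_simplex[OF k'] using \<rho>(1)
      by (intro vertex_simplex_avoids_barycentre)
  qed
  have last: "singular_face (Suc n) (Suc n) (?s a) = singular_face (Suc n) (Suc n) (?s b)"
    by (simp add: singular_face_vertex_simplex) (rule vertex_simplex_cong, simp add: v_def skip_def)
  have "chain_boundary (Suc n) ?c =
     (\<Sum>k\<le>n. frag_cmul ((-1) ^ k) (frag_of (singular_face (Suc n) k (?s a)))) -
     (\<Sum>k\<le>n. frag_cmul ((-1) ^ k) (frag_of (singular_face (Suc n) k (?s b))))"
    unfolding chain_boundary_diff chain_boundary_of by (simp add: last)
  also have "singular_chain n (subtopology ?X ?S) \<dots>"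
    using fch by (intro singular_chain_diff singular_chain_sum singular_chain_cmul) auto
  finally have "singular_relcycle (Suc n) ?X ?S ?c"
    using ss by (simp add: singular_relcycle singular_chain_diff singular_chain_of)
  then have "singular_relboundary (Suc n) ?X ?S ?c"
    using triv by (intro relboundary_if_trivial) (simp_all add: n)
  then obtain f g where f: "singular_chain (Suc (Suc n)) ?X f"
    and g: "singular_chain (Suc n) (subtopology ?X ?S) g"
    and "?c = chain_boundary (Suc (Suc n)) f + g"
    by (auto simp: singular_relboundary)
  then have eq: "frag_of (?s a) = frag_cmul 2 0 + chain_boundary (Suc (Suc n)) f + g + frag_of (?s b)"
    by (simp add: algebra_simps)
  define \<delta> where "\<delta> = 1 / (1 + real n)"
  have \<delta>: "\<delta> > 0" "?p (u j) = \<delta>" if "j \<le> n" for j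
    using u\<rho>[OF that] n by (auto simp: barycentre_def \<delta>_def)
  define Q where "Q t i \<longleftrightarrow> 1 \<le> i \<and> i \<le> n \<and> \<delta> < t (u i)" for t i
  \<comment> \<open>Label \<open>0\<close> is the default, taken when no \<open>t (u i)\<close> with
    \<open>1 \<le> i\<close> exceeds \<delta> and \<open>t a\<close> does not exceed
    \<open>t b\<close>. All labels are at most \<open>Suc n\<close>, so the whole space can serve as
    \<open>W\<close>.\<close>
  define L where "L t = (if \<exists>i. Q t i then SOME i. Q t i else if t b < t a then Suc n else 0)" for t
  have LQ: "Q t (L t)" if "1 \<le> L t" "L t \<le> n" for t
    using that someI_ex[of "Q t"] unfolding L_def by (auto split: if_splits)
  have LQ': "Q t (L t)" if "Q t i" for t i
    using that someI_ex[of "Q t"] unfolding L_def by auto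
  have L_le: "L t \<le> Suc n" for t
  proof (cases "\<exists>i. Q t i")
    case True
    then have "Q t (L t)" using LQ' by blast
    then show ?thesis by (simp add: Q_def)
  qed (simp add: L_def)
  have L0: "t (u i) \<le> \<delta>" if "L t = 0" "1 \<le> i" "i \<le> n" for t i
    using LQ'[of t i] that by (auto simp: Q_def not_less[symmetric])
  have L0': "t a \<le> t b" if "L t = 0" for t
  proof -
    have "\<not> Q t j" for j using LQ'[of t j] that by (auto simp: Q_def)
    then show "t a \<le> t b" using that by (auto simp: L_def not_less split: if_splits)
  qed
  have LS: "t b < t a" if "L t = Suc n" for t
  proof -
    have "\<not> Q t j" for j using LQ'[of t j] that by (auto simp: Q_def)
    then show ?thesis using that by (auto simp: L_def split: if_splits)
  qed
  \<comment> \<open>Where label \<open>0\<close> is taken, all the functions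
    \<open>t (u j) - \<delta>\<close> and \<open>t a - t b\<close> are nonpositive. Positivity of
    their sum is thus an open condition that excludes label \<open>0\<close>, and where no
    \<open>U i\<close> applies all of them must vanish.\<close>
  define U where "U i = {t \<in> topspace ?X. if i = 0 then 0 < (\<Sum>j\<in>{1..n}. t (u j) - \<delta>) + (t a - t b)
      else if i \<le> n then t (u i) < \<delta> else t a < t b}" for i
  have "frag_of (?s a) \<noteq> frag_cmul 2 0 + chain_boundary (Suc (Suc n)) f + g + frag_of (?s b)"
  proof (rule sperner_obstruction[where L=L and U=U and W="topspace ?X" and j="Suc n", OF _ _ _ _ _ _ _ _ _ f g])
    show "openin ?X (U i)" for i
    proof -
      consider "i = 0" | "1 \<le> i" "i \<le> n" | "n < i" by linarith
      then show ?thesis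
        by cases (auto simp: U_def intro!: openin_realization_less continuous_intros continuous_map_sum
            continuous_map_add continuous_map_diff)
    qed
    show "L t \<noteq> i" if t: "i \<le> Suc n" "t \<in> U i" for i t
    proof
      assume i: "L t = i"
      consider "i = 0" | "1 \<le> i" "i \<le> n" | "i = Suc n" using t by linarith
      then show False
      proof cases
        case 1
        have "(\<Sum>j\<in>{1..n}. t (u j) - \<delta>) \<le> 0"
        proof (rule sum_nonpos)
          fix j assume "j \<in> {1..n}"
          then show "t (u j) - \<delta> \<le> 0" using L0[of t j] i 1 by simp
        qed
        then show False using t(2) L0'[of t] i 1 by (simp add: U_def)
      next
        case 2
        then show False using t(2) LQ[of t] i by (simp add: U_def Q_def)
      next
        case 3
        then show False using t(2) LS[of t] i by (simp add: U_def)
      qed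
    qed
    show "topspace ?X \<inter> ?S \<subseteq> (\<Union>i\<le>Suc n. U i)"
    proof
      fix t assume "t \<in> topspace ?X \<inter> ?S"
      then have t: "t \<in> topspace ?X" "t \<noteq> ?p" by auto
      show "t \<in> (\<Union>i\<le>Suc n. U i)"
      proof (rule ccontr)
        assume "t \<notin> (\<Union>i\<le>Suc n. U i)"
        then have nU: "t \<notin> U i" if "i \<le> Suc n" for i using that by auto
        have 1: "\<delta> \<le> t (u j)" if "j \<in> {1..n}" for j
          using nU[of j] that t(1) by (auto simp: U_def split: if_splits)
        have 2: "t b \<le> t a" using nU[of "Suc n"] t(1) by (auto simp: U_def)
        have 3: "(\<Sum>j\<in>{1..n}. t (u j) - \<delta>) + (t a - t b) \<le> 0" using nU[of 0] t(1) by (auto simp: U_def)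
        have 4: "(\<Sum>j\<in>{1..n}. t (u j) - \<delta>) \<ge> 0" using 1 by (intro sum_nonneg) auto
        have 5: "t a = t b" using 2 3 4 by linarith
        have 6: "t (u j) = \<delta>" if "j \<in> {1..n}" for j
        proof -
          have "(\<Sum>j\<in>{1..n}. t (u j) - \<delta>) = 0" using 2 3 4 by linarith
          then have "t (u j) - \<delta> = 0"
            using sum_nonneg_0[of "{1..n}" "\<lambda>j. t (u j) - \<delta>" j] 1 that by auto
          then show ?thesis by simp
        qed
        obtain w where w: "w \<in> {a, b}" "{v. t v \<noteq> 0} \<subseteq> insert w \<rho>" "sum t (insert w \<rho>) = 1"
          using t(1) \<rho>(1) by (rule book_realizationE)
        \<comment> \<open>No point has nonzero coordinates at both \<open>a\<close> and
          \<open>b\<close>, so equal coordinates there are both zero and the point lies on \<rho>.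
          The remaining coordinate \<open>t (u 0)\<close> is then
          \<open>1 - n \<delta> = \<delta>\<close>.\<close>
        have "t a = 0 \<or> t b = 0" using w(1,2) \<rho>(3-5) by blast
        then have "t w = 0" using 5 w(1) by auto
        moreover have "w \<notin> \<rho>" using w(1) \<rho>(3,4) by auto
        ultimately have "sum t \<rho> = 1" using w(3) \<rho>(1) by simp
        then have "(\<Sum>j\<le>n. t (u j)) = 1" using sums by simp
        also have "(\<Sum>j\<le>n. t (u j)) = t (u 0) + (\<Sum>j\<in>{1..n}. t (u j))"
          by (simp add: atMost_atLeast0 sum.atLeast_Suc_atMost)
        also have "(\<Sum>j\<in>{1..n}. t (u j)) = real n * \<delta>" using 6 by simp
        finally have "t (u 0) = \<delta>" by (simp add: \<delta>_def field_simps)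
        then have all: "t (u j) = \<delta>" if "j \<le> n" for j using 6[of j] that by (cases "j = 0") auto
        have "t = ?p"
        proof (rule eq_barycentre[OF t(1) \<rho>(1,2)])
          fix x assume "x \<in> \<rho>"
          then obtain j where "j \<le> n" "x = u j" using u by (auto simp: bij_betw_def)
          then show "1 / real (card \<rho>) \<le> t x" using all n by (simp add: \<delta>_def)
        qed
        then show False using t by simp
      qed
    qed
    show "singular_simplex (Suc n) ?X (?s a)" using ss by simp
    show "L (?s a x) \<noteq> i" if x: "x \<in> standard_simplex (Suc n)" "i \<le> Suc n" "x i = 0" for x i
    proof
      assume i: "L (?s a x) = i"
      have sa: "?s a x (v a j) = x j" if "j \<le> Suc n" for j
        using that x \<rho> by (intro vertex_simplex_apply vinj) auto
      have sb: "?s a x b = 0" using x \<rho> by (intro vertex_simplex_outside) (auto simp: vim)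
      have xa: "?s a x a = x (Suc n)" using sa[of "Suc n"] by (simp add: v_def)
      have xu: "?s a x (u j) = x j" if "j \<le> n" for j using sa[of j] that by (simp add: v_def)
      consider "i = 0" | "1 \<le> i" "i \<le> n" | "i = Suc n" using x by linarith
      then show False
      proof cases
        case 1
        then have le: "x j \<le> \<delta>" if "1 \<le> j" "j \<le> n" for j using L0[of "?s a x" j] i that xu by simp
        have "x (Suc n) \<le> 0" using L0'[of "?s a x"] i 1 xa sb by simp
        moreover have "1 = (\<Sum>j\<le>Suc n. x j)" using x by (simp add: standard_simplex_def)
        moreover have "(\<Sum>j\<le>Suc n. x j) = x 0 + (\<Sum>j\<in>{1..n}. x j) + x (Suc n)"
          by (simp add: atMost_atLeast0 sum.atLeast_Suc_atMost)
        moreover have "(\<Sum>j\<in>{1..n}. x j) \<le> (\<Sum>j\<in>{1..n}. \<delta>)" using le by (intro sum_mono) auto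
        \<comment> \<open>There are only \<open>n\<close> summands of size
          \<open>1 / (n + 1)\<close>: without the coordinate at index 0, the values cannot all stay
          within the bounds that label \<open>0\<close> imposes.\<close>
        moreover have "(\<Sum>j\<in>{1..n}. \<delta>) < 1" by (simp add: \<delta>_def)
        ultimately show False using x(3) 1 by simp
      next
        case 2
        then show False using LQ[of "?s a x"] i xu[of i] x(3) \<delta>(1)[of 0] by (simp add: Q_def)
      next
        case 3
        then show False using LS[of "?s a x"] i xa sb x(3) by simp
      qed
    qed
    show "singular_chain (Suc n) (subtopology ?X {x. L x \<noteq> Suc n}) (frag_of (?s b))"
    proof -
      have "L (?s b x) \<noteq> Suc n" if x: "x \<in> standard_simplex (Suc n)" for x
      proof
        assume "L (?s b x) = Suc n"
        then have "?s b x b < ?s b x a" using LS by blast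
        moreover have "?s b x a = 0" using x \<rho> by (intro vertex_simplex_outside) (auto simp: vim)
        moreover have "?s b x \<in> topspace ?X"
          using ss[of b] x by (auto simp: singular_simplex_def continuous_map_def)
        ultimately show False using realization_nonneg[of "?s b x" _ b] by fastforce
      qed
      then show ?thesis using ss by (auto simp: singular_chain_of singular_simplex_subtopology)
    qed
  qed (auto simp: L_le)
  then show False using eq by simp
qed

text \<open>The retraction of the book onto the pages \<open>a\<close> and \<open>b\<close> that
  folds all other pages onto \<open>b\<close>. On points of the book at most one summand of the
  coordinate at \<open>b\<close> is nonzero; writing a sum makes continuity evident without
  distinguishing the pages.\<close>

definition fold_pages :: "'a set \<Rightarrow> 'a set \<Rightarrow> 'a \<Rightarrow> 'a \<Rightarrow> ('a \<Rightarrow> real) \<Rightarrow> 'a \<Rightarrow> real" where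
  "fold_pages \<rho> W a b t = (\<lambda>x. if x \<in> insert a \<rho> then t x else if x = b then \<Sum>w\<in>W - {a}. t w else 0)"

lemma fold_pages_in_realization:
  assumes \<rho>: "finite \<rho>" "finite W" "\<rho> \<inter> W = {}" "a \<in> W" "b \<in> W" "a \<noteq> b"
    and t: "t \<in> topspace (geometric_realization (book \<rho> W))"
  shows "fold_pages \<rho> W a b t \<in> topspace (geometric_realization (book \<rho> {a, b}))"
    and "t a = 0 \<Longrightarrow> fold_pages \<rho> W a b t \<in> topspace (geometric_realization (book \<rho> {b}))"
proof -
  let ?t = "fold_pages \<rho> W a b t"
  obtain w where w: "w \<in> W" "{v. t v \<noteq> 0} \<subseteq> insert w \<rho>" "sum t (insert w \<rho>) = 1"
    using t \<rho>(1) by (rule book_realizationE)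
  have nn: "0 \<le> ?t v" for v
    using realization_nonneg[OF t] by (simp add: fold_pages_def sum_nonneg)
  have tz: "t v = 0" if "v \<in> W" "v \<noteq> w" for v using that w(2) \<rho> by auto
  have wn: "w \<notin> \<rho>" "a \<notin> \<rho>" "b \<notin> \<rho>" using w \<rho> by auto
  have same: "sum ?t \<rho> = sum t \<rho>" by (intro sum.cong) (auto simp: fold_pages_def)
  have ta: "?t \<in> topspace (geometric_realization (book \<rho> V))" if "t a = 0" "b \<in> V" for V
  proof (rule book_realizationI[OF nn \<open>b \<in> V\<close>])
    show "{v. ?t v \<noteq> 0} \<subseteq> insert b \<rho>" using that by (auto simp: fold_pages_def)
    have "?t b = (\<Sum>v\<in>W - {a}. t v)" using wn \<rho>(6) by (simp add: fold_pages_def)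
    also have "\<dots> = (\<Sum>v\<in>W. t v)" using \<rho> that by (intro sum.mono_neutral_left) auto
    also have "\<dots> = (\<Sum>v\<in>{w}. t v)" using \<rho> w tz by (intro sum.mono_neutral_right) auto
    finally show "sum ?t (insert b \<rho>) = 1" using w(3) wn \<rho>(1) same by simp
  qed (use \<rho> in auto)
  show "?t \<in> topspace (geometric_realization (book \<rho> {b}))" if "t a = 0"
    using ta[OF that] by simp
  show "?t \<in> topspace (geometric_realization (book \<rho> {a, b}))"
  proof (cases "w = a")
    case True
    have z: "(\<Sum>v\<in>W - {a}. t v) = 0" using tz True by (intro sum.neutral) auto
    show ?thesis
    proof (rule book_realizationI[OF nn])
      show "{v. ?t v \<noteq> 0} \<subseteq> insert a \<rho>" using z by (auto simp: fold_pages_def)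
      have "?t a = t a" by (simp add: fold_pages_def)
      then show "sum ?t (insert a \<rho>) = 1" using w(3) wn \<rho>(1) same True by simp
    qed (use \<rho> in auto)
  next
    case False
    then have "t a = 0" using tz \<rho> by auto
    then show ?thesis using ta by simp
  qed
qed

lemma continuous_map_fold_pages:
  assumes "continuous_map Y (geometric_realization (book \<rho> W)) id"
    and "\<And>t. t \<in> topspace Y \<Longrightarrow> fold_pages \<rho> W a b t \<in> topspace (geometric_realization K)"
  shows "continuous_map Y (geometric_realization K) (fold_pages \<rho> W a b)"
proof (rule continuous_map_into_realization[OF _ assms(2)])
  fix v
  have c: "continuous_map Y euclideanreal (\<lambda>t. t w)" for w
    using continuous_map_compose[OF assms(1) continuous_map_coordinate] by (simp add: o_def)
  consider "v \<in> insert a \<rho>" | "v \<notin> insert a \<rho>" "v = b" | "v \<notin> insert a \<rho>" "v \<noteq> b" by blast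
  then show "continuous_map Y euclideanreal (\<lambda>t. fold_pages \<rho> W a b t v)"
  proof cases
    case 2
    have "continuous_map Y euclideanreal (\<lambda>t. \<Sum>w\<in>W - {a}. t w)"
      by (cases "finite (W - {a})") (auto intro!: continuous_map_sum c)
    then show ?thesis using 2 by (simp add: fold_pages_def)
  qed (auto simp: fold_pages_def c)
qed auto

text \<open>Folding keeps the coordinates on \<rho>, and these determine the barycentre. Hence
  folding maps the punctured book into the punctured book.\<close>

lemma fold_pages_eq_barycentre:
  assumes "finite \<rho>" "\<rho> \<noteq> {}" "t \<in> topspace (geometric_realization K)"
    and "fold_pages \<rho> W a b t = barycentre \<rho>"
  shows "t = barycentre \<rho>"
proof (rule eq_barycentre[OF assms(3,1,2)])
  fix x assume "x \<in> \<rho>"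
  then show "1 / real (card \<rho>) \<le> t x"
    using fun_cong[OF assms(4), of x] by (simp add: fold_pages_def barycentre_def)
qed

lemma fold_pages_id:
  assumes \<rho>: "finite \<rho>" "finite W" "\<rho> \<inter> W = {}" "a \<in> W" "b \<in> W" "a \<noteq> b"
    and t: "t \<in> topspace (geometric_realization (book \<rho> {a, b}))"
  shows "fold_pages \<rho> W a b t = t"
proof
  fix x
  obtain w where w: "w \<in> {a, b}" "{v. t v \<noteq> 0} \<subseteq> insert w \<rho>"
    using t \<rho>(1) by (rule book_realizationE)
  have "(\<Sum>w\<in>W - {a}. t w) = (\<Sum>w\<in>{b}. t w)"
    using \<rho> w by (intro sum.mono_neutral_right) auto
  then show "fold_pages \<rho> W a b t x = t x" using w by (auto simp: fold_pages_def)
qed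

text \<open>The books with pages \<open>{a, b}\<close> and \<open>{b, c}\<close> are retracts by
  folding, so their nontrivial groups are summands. Folding onto \<open>{a, b}\<close> sends the
  book on \<open>{b, c}\<close> into the single page \<open>b\<close>, whose local homology
  vanishes; this makes the summands independent.\<close>

lemma local_homology_three_pages:
  assumes \<rho>: "finite \<rho>" "\<rho> \<noteq> {}" "finite W" "\<rho> \<inter> W = {}"
    and abc: "a \<in> W" "b \<in> W" "c \<in> W" "a \<noteq> b" "b \<noteq> c" "a \<noteq> c"
  shows "\<not> local_homology_group (int (card \<rho>)) (geometric_realization (book \<rho> W)) (barycentre \<rho>)
           \<cong> integer_group"
proof -
  let ?n = "int (card \<rho>)" and ?p = "barycentre \<rho>"
  let ?X = "\<lambda>V. geometric_realization (book \<rho> V)"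
  let ?S = "\<lambda>V. topspace (?X V) - {?p}"
  let ?H = "\<lambda>V. relative_homology_group ?n (?X V) (?S V)"
  have sub: "?S V \<subseteq> ?S W" if "V \<subseteq> W" for V
    using realization_mono[OF book_mono[OF that]] by blast
  have cid: "continuous_map (?X V) (?X W) id" if "V \<subseteq> W" for V
    using realization_subtopology[OF book_mono[OF that]] by (metis continuous_map_from_subtopology continuous_map_id)
  let ?i = "\<lambda>V. hom_induced ?n (?X V) (?S V) (?X W) (?S W) id"
  have F: "continuous_map (?X W) (?X {x, y}) (fold_pages \<rho> W x y)"
          "fold_pages \<rho> W x y \<in> ?S W \<rightarrow> ?S {x, y}"
    if "x \<in> W" "y \<in> W" "x \<noteq> y" for x y
    using that \<rho> fold_pages_in_realization(1)[OF \<rho>(1,3,4) that] fold_pages_eq_barycentre[OF \<rho>(1,2)]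
    by (auto intro!: continuous_map_fold_pages)
  let ?F = "\<lambda>x y. hom_induced ?n (?X W) (?S W) (?X {x, y}) (?S {x, y}) (fold_pages \<rho> W x y)"
  have Fi: "?F x y (?i {x, y} z) = z" if "x \<in> W" "y \<in> W" "x \<noteq> y" and z: "z \<in> carrier (?H {x, y})" for x y z
  proof -
    have "?F x y (?i {x, y} z) = hom_induced ?n (?X {x, y}) (?S {x, y}) (?X {x, y}) (?S {x, y}) (fold_pages \<rho> W x y \<circ> id) z"
      using that F[OF that(1-3)] cid[of "{x, y}"] sub[of "{x, y}"] by (intro hom_induced_compose') auto
    also have "\<dots> = z"
    proof (rule hom_induced_id_gen[OF _ _ z])
      show "continuous_map (?X {x, y}) (?X {x, y}) (fold_pages \<rho> W x y \<circ> id)"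
        using that(1,2) by (intro continuous_map_compose[OF cid F(1)[OF that(1-3)]]) auto
    qed (use fold_pages_id[OF \<rho>(1,3,4) that(1-3)] in simp)
    finally show ?thesis .
  qed
  have 0: "?F a b (?i {b, c} z) = \<one>\<^bsub>?H {a, b}\<^esub>" if z: "z \<in> carrier (?H {b, c})" for z
  proof -
    have img: "fold_pages \<rho> W a b t \<in> topspace (?X {b})" if t: "t \<in> topspace (?X {b, c})" for t
    proof -
      have "t a = 0"
        using t \<rho>(1) abc \<rho>(4) by (elim book_realizationE) auto
      then show ?thesis using fold_pages_in_realization(2)[OF \<rho>(1,3,4) abc(1,2,4)]
        t realization_mono[OF book_mono[of "{b, c}" W \<rho>]] abc by blast
    qed
    have "?F a b (?i {b, c} z) = hom_induced ?n (?X {b, c}) (?S {b, c}) (?X {a, b}) (?S {a, b}) (fold_pages \<rho> W a b \<circ> id) z"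
      using F[OF abc(1,2,4)] cid[of "{b, c}"] sub[of "{b, c}"] abc by (intro hom_induced_compose') auto
    also have "\<dots> = hom_induced ?n (?X {b, c}) (?S {b, c}) (?X {a, b}) (?S {a, b}) (id \<circ> fold_pages \<rho> W a b) z"
      by simp
    also have "\<dots> = hom_induced ?n (?X {b}) (?S {b}) (?X {a, b}) (?S {a, b}) id
                       (hom_induced ?n (?X {b, c}) (?S {b, c}) (?X {b}) (?S {b}) (fold_pages \<rho> W a b) z)"
    proof (rule hom_induced_compose'[symmetric])
      show "continuous_map (?X {b, c}) (?X {b}) (fold_pages \<rho> W a b)"
        using img cid[of "{b, c}"] abc by (intro continuous_map_fold_pages) auto
      show "fold_pages \<rho> W a b \<in> ?S {b, c} \<rightarrow> ?S {b}"
        using img fold_pages_eq_barycentre[OF \<rho>(1,2)] by blast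
      show "continuous_map (?X {b}) (?X {a, b}) id"
        using realization_subtopology[OF book_mono[of "{b}" "{a, b}" \<rho>]]
        by (metis continuous_map_from_subtopology continuous_map_id insertI1 insert_subset subset_insertI)
      show "id \<in> ?S {b} \<rightarrow> ?S {a, b}"
        using realization_mono[OF book_mono[of "{b}" "{a, b}" \<rho>]] by auto
    qed
    also have "hom_induced ?n (?X {b, c}) (?S {b, c}) (?X {b}) (?S {b}) (fold_pages \<rho> W a b) z = \<one>\<^bsub>?H {b}\<^esub>"
    proof -
      have "b \<notin> \<rho>" using abc \<rho> by auto
      then have "trivial_group (?H {b})" using local_homology_one_page[OF \<rho>(1,2)] by blast
      then have "carrier (?H {b}) = {\<one>\<^bsub>?H {b}\<^esub>}" by (simp only: trivial_group_def)
      then show ?thesis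
        using hom_induced_carrier[of ?n "?X {b, c}" "?S {b, c}" "?X {b}" "?S {b}" "fold_pages \<rho> W a b" z]
        by blast
    qed
    also have "hom_induced ?n (?X {b}) (?S {b}) (?X {a, b}) (?S {a, b}) id \<dots> = \<one>\<^bsub>?H {a, b}\<^esub>"
      by (rule hom_one[OF hom_induced_hom]) auto
    finally show ?thesis .
  qed
  have cb: "{c, b} = {b, c}" by auto
  have no: "\<not> trivial_group (?H {x, y})" if "x \<in> W" "y \<in> W" "x \<noteq> y" for x y
    using local_homology_two_pages[OF \<rho>(1,2), of x y] that \<rho> by auto
  show ?thesis
  proof (rule not_iso_integer_group_if_two_summands[where A="?H {a, b}" and B="?H {b, c}" and G="?H W"
        and i="?i {a, b}" and j="?i {b, c}" and F="?F a b" and F'="?F c b"])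
    show "?F c b \<in> hom (?H W) (?H {b, c})" unfolding cb by (rule hom_induced_hom)
    show "?F c b (?i {b, c} y) = y" if "y \<in> carrier (?H {b, c})" for y
      using Fi[of c b y] that abc unfolding cb by simp
    show "\<not> trivial_group (?H {a, b})" "\<not> trivial_group (?H {b, c})" using no abc by auto
    show "?F a b (?i {a, b} x) = x" if "x \<in> carrier (?H {a, b})" for x
      using Fi that abc by simp
    show "?F a b (?i {b, c} y) = \<one>\<^bsub>?H {a, b}\<^esub>" if "y \<in> carrier (?H {b, c})" for y
      by (rule 0[OF that])
  qed (rule hom_induced_hom group_relative_homology_group)+
qed

section \<open>Graded posets\<close>

lemma local_homology_maximal_simplex:
  assumes v: "inj_on v {..p}" and K: "\<And>B. \<lbrakk>B \<subseteq> v ` {..p}; B \<noteq> {}\<rbrakk> \<Longrightarrow> B \<in> K"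
    and max: "\<And>B. \<lbrakk>B \<in> K; v ` {..p} \<subseteq> B\<rbrakk> \<Longrightarrow> B = v ` {..p}"
  shows "\<not> trivial_group (local_homology_group (int p) (geometric_realization K) (barycentre (v ` {..p})))"
proof
  let ?X = "geometric_realization K"
  let ?S = "topspace ?X - {barycentre (v ` {..p})}"
  let ?c = "frag_of (vertex_simplex p v)"
  assume triv: "trivial_group (local_homology_group (int p) ?X (barycentre (v ` {..p})))"
  have "singular_chain (p - Suc 0) (subtopology ?X ?S) (chain_boundary p ?c)"
  proof (cases p)
    case (Suc q)
    have "singular_chain q (subtopology ?X ?S) (frag_of (singular_face (Suc q) k (vertex_simplex (Suc q) v)))"
      if k: "k \<le> Suc q" for k
    proof -
      have im: "(v \<circ> skip k) ` {..q} = v ` ({..p} - {k})"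
        unfolding image_comp[symmetric] image_skip[OF k] using Suc by simp
      have inj: "inj_on (v \<circ> skip k) {..q}"
        using v Suc by (intro comp_inj_on inj_skip) (auto simp: image_skip[OF k] intro: inj_on_subset)
      have "v k \<notin> v ` ({..p} - {k})"
        using v k Suc by (simp add: inj_on_image_mem_iff)
      then have "\<not> v ` {..p} \<subseteq> (v \<circ> skip k) ` {..q}" unfolding im using k Suc by blast
      then show ?thesis
        unfolding singular_face_vertex_simplex[OF k]
        using v Suc im
        by (intro vertex_simplex_avoids_barycentre inj K) auto
    qed
    then have "singular_chain q (subtopology ?X ?S)
        (\<Sum>k\<le>Suc q. frag_cmul ((-1) ^ k) (frag_of (singular_face (Suc q) k (vertex_simplex (Suc q) v))))"
      by (intro singular_chain_sum singular_chain_cmul) auto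
    then show ?thesis using Suc by (simp add: chain_boundary_of del: sum.atMost_Suc)
  qed (simp add: chain_boundary_of)
  moreover have "singular_chain p ?X ?c"
    using singular_simplex_vertex_simplex[OF v K] by (simp add: singular_chain_of)
  ultimately have "singular_relcycle p ?X ?S ?c" by (simp add: singular_relcycle)
  then have "singular_relboundary p ?X ?S ?c"
    using triv by (rule relboundary_if_trivial[rotated])
  then obtain f g where "singular_chain (Suc p) ?X f" "singular_chain p (subtopology ?X ?S) g"
    "?c = chain_boundary (Suc p) f + g"
    by (auto simp: singular_relboundary)
  then show False
    using maximal_simplex_obstruction[OF v K max, of f g 0] by simp
qed

lemma homology_manifold_homeomorphic:
  assumes X: "homology_manifold n X" and hom: "Y homeomorphic_space X"
  shows "homology_manifold n Y"
proof -
  obtain h where h: "homeomorphic_map Y X h"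
    using hom by (auto simp: homeomorphic_space)
  have iso: "local_homology_group i Y y \<cong> local_homology_group i X (h y)" if y: "y \<in> topspace Y" for i y
  proof -
    have "h ` (topspace Y - {y}) = topspace X - {h y}"
      using h y by (auto simp: homeomorphic_eq_everything_map inj_on_def)
    then show ?thesis
      using homeomorphic_map_relative_homology_iso[OF h, of "topspace Y - {y}" "topspace X - {h y}" i]
      by (auto simp: is_iso_def)
  qed
  have hX: "h y \<in> topspace X" if "y \<in> topspace Y" for y
    using h that by (auto simp: homeomorphic_eq_everything_map)
  have H: "if i = int n then local_homology_group i X x \<cong> integer_group
      else trivial_group (local_homology_group i X x)" if "x \<in> topspace X" for x i
    using X that unfolding homology_manifold_def by blast
  show ?thesis
    unfolding homology_manifold_def
  proof (intro ballI allI)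
    fix y i assume y: "y \<in> topspace Y"
    note H' = H[OF hX[OF y], of i] and I = iso[OF y, of i]
    show "if i = int n then local_homology_group i Y y \<cong> integer_group
      else trivial_group (local_homology_group i Y y)"
    proof (cases "i = int n")
      case True
      then have "local_homology_group i X (h y) \<cong> integer_group" using H' by (simp only: if_True)
      with I have "local_homology_group i Y y \<cong> integer_group" by (rule iso_trans)
      then show ?thesis unfolding if_P[OF True] .
    next
      case False
      then have "trivial_group (local_homology_group i X (h y))" using H' by (simp only: if_False)
      then have "trivial_group (local_homology_group i Y y)"
        using isomorphic_group_triviality[OF I] by (simp only: group_relative_homology_group)
      then show ?thesis unfolding if_not_P[OF False] .
    qed
  qed
qed

section \<open>Maximal chains, ranks and facets\<close>

locale graded_poset =
  fixes P :: "'a set" and R :: "'a rel" and r :: "'a \<Rightarrow> nat" and m :: nat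
  assumes fin: "finite P" and po: "partial_order_on P R"
    and graded: "graded_of_rank R m" and rank: "rank_function P R r"
begin

lemma
  shows R_trans: "\<lbrakk>(x, y) \<in> R; (y, z) \<in> R\<rbrakk> \<Longrightarrow> (x, z) \<in> R"
    and R_antisym: "\<lbrakk>(x, y) \<in> R; (y, x) \<in> R\<rbrakk> \<Longrightarrow> x = y"
    and R_refl: "x \<in> P \<Longrightarrow> (x, x) \<in> R"
    and R_in: "(x, y) \<in> R \<Longrightarrow> x \<in> P \<and> y \<in> P"
proof -
  have "trans R" "antisym R" "refl_on P R" "R \<subseteq> P \<times> P"
    using po by (auto simp: partial_order_on_def preorder_on_def)
  then show "\<lbrakk>(x, y) \<in> R; (y, z) \<in> R\<rbrakk> \<Longrightarrow> (x, z) \<in> R" "\<lbrakk>(x, y) \<in> R; (y, x) \<in> R\<rbrakk> \<Longrightarrow> x = y"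
    "x \<in> P \<Longrightarrow> (x, x) \<in> R" "(x, y) \<in> R \<Longrightarrow> x \<in> P \<and> y \<in> P"
    by (blast dest: transD antisymD refl_onD)+
qed

lemma chain_subset: "C \<in> Chains R \<Longrightarrow> C \<subseteq> P"
  using R_in by (auto simp: Chains_def)

lemma chain_finite: "C \<in> Chains R \<Longrightarrow> finite C"
  using chain_subset fin finite_subset by blast

lemma chain_mono: "\<lbrakk>C \<in> Chains R; D \<subseteq> C\<rbrakk> \<Longrightarrow> D \<in> Chains R"
  by (auto simp: Chains_def)

lemma chain_greatest:
  assumes "C \<in> Chains R" "C \<noteq> {}"
  shows "\<exists>y\<in>C. \<forall>z\<in>C. (z, y) \<in> R"
  using chain_finite[OF assms(1)] assms(2,1)
proof (induction rule: finite_ne_induct)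
  case (singleton x)
  then show ?case by (auto simp: Chains_def)
next
  case (insert x C)
  have "C \<in> Chains R" using chain_mono[OF insert.prems] by auto
  with insert.IH obtain y where y: "y \<in> C" "\<forall>z\<in>C. (z, y) \<in> R" by blast
  have "(x, x) \<in> R" "(x, y) \<in> R \<or> (y, x) \<in> R" using insert.prems y by (auto simp: Chains_def)
  then show ?case using y R_trans by blast
qed

lemma chain_least:
  assumes "C \<in> Chains R" "C \<noteq> {}"
  shows "\<exists>y\<in>C. \<forall>z\<in>C. (y, z) \<in> R"
  using chain_finite[OF assms(1)] assms(2,1)
proof (induction rule: finite_ne_induct)
  case (singleton x)
  then show ?case by (auto simp: Chains_def)
next
  case (insert x C)
  have "C \<in> Chains R" using chain_mono[OF insert.prems] by auto
  with insert.IH obtain y where y: "y \<in> C" "\<forall>z\<in>C. (y, z) \<in> R" by blast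
  have "(x, x) \<in> R" "(x, y) \<in> R \<or> (y, x) \<in> R" using insert.prems y by (auto simp: Chains_def)
  then show ?case using y R_trans by blast
qed

lemma maximal_chain_extension:
  assumes "C \<in> Chains R"
  obtains D where "maximal_chain R D" "C \<subseteq> D"
proof -
  have "finite {D \<in> Chains R. C \<subseteq> D}"
    by (rule finite_subset[of _ "Pow P"]) (use chain_subset fin in blast, simp add: fin)
  then obtain D where "D \<in> {D \<in> Chains R. C \<subseteq> D}" "\<forall>E \<in> {D \<in> Chains R. C \<subseteq> D}. D \<subseteq> E \<longrightarrow> D = E"
    using finite_has_maximal[of "{D \<in> Chains R. C \<subseteq> D}"] assms by blast
  then show thesis using that[of D] by (auto simp: maximal_chain_def)
qed

text \<open>The rank function is tied only to minimal elements and covers of \<open>P\<close>.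
  Maximality of \<open>C\<close> transfers both: its least element is minimal in \<open>P\<close>,
  and consecutive elements of \<open>C\<close> are covers in \<open>P\<close>, so the rank starts at
  0 and grows by 1.\<close>

lemma rank_eq_card_below:
  assumes C: "maximal_chain R C" and "x \<in> C"
  shows "r x = card {y \<in> C. (y, x) \<in> R \<and> y \<noteq> x}"
  using assms(2)
proof (induction "card {y \<in> C. (y, x) \<in> R \<and> y \<noteq> x}" arbitrary: x rule: less_induct)
  case less
  let ?B = "\<lambda>x. {y \<in> C. (y, x) \<in> R \<and> y \<noteq> x}"
  have ch: "C \<in> Chains R" and mx: "\<And>D. \<lbrakk>D \<in> Chains R; C \<subseteq> D\<rbrakk> \<Longrightarrow> D = C"
    using C by (auto simp: maximal_chain_def)
  have xP: "x \<in> P" using chain_subset[OF ch] less.prems by auto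
  have cmp: "(c, x) \<in> R \<or> (x, c) \<in> R" if "c \<in> C" for c
    using ch that less.prems by (auto simp: Chains_def)
  \<comment> \<open>Maximality in usable form: whatever is comparable with all of \<open>C\<close>
    could be inserted, hence belongs to \<open>C\<close>.\<close>
  have ins: "z \<in> C" if z: "z \<in> P" "\<And>c. c \<in> C \<Longrightarrow> (c, z) \<in> R \<or> (z, c) \<in> R" for z
  proof -
    have "insert z C \<in> Chains R" using ch z R_refl by (auto simp: Chains_def)
    then show ?thesis using mx[of "insert z C"] by blast
  qed
  show ?case
  proof (cases "?B x = {}")
    case True
    have "z = x" if z: "(z, x) \<in> R" for z
    proof -
      have "z \<in> C"
      proof (rule ins)
        fix c assume c: "c \<in> C"
        then have "(x, c) \<in> R" using True cmp by auto
        then show "(c, z) \<in> R \<or> (z, c) \<in> R" using z R_trans by blast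
      qed (use R_in z in blast)
      then show ?thesis using z True by blast
    qed
    then have "minimal_in P R x" using xP by (auto simp: minimal_in_def)
    then have "r x = 0" using rank by (auto simp: rank_function_def)
    then show ?thesis by (simp only: True card.empty)
  next
    case False
    have "?B x \<in> Chains R" using chain_mono[OF ch] by auto
    then obtain y where y: "y \<in> ?B x" "\<And>z. z \<in> ?B x \<Longrightarrow> (z, y) \<in> R"
      using chain_greatest False by blast
    have "covers R x y"
      unfolding covers_def
    proof (intro conjI allI impI)
      fix z assume z: "(y, z) \<in> R" "(z, x) \<in> R"
      have "z \<in> C"
      proof (rule ins)
        fix c assume c: "c \<in> C"
        then consider "c \<in> ?B x" | "(x, c) \<in> R" using cmp by blast
        then show "(c, z) \<in> R \<or> (z, c) \<in> R"
          by cases (use y z R_trans in blast)+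
      qed (use R_in z in blast)
      then show "z = y \<or> z = x" using y(2)[of z] z R_antisym by blast
    qed (use y in auto)
    then have "r x = r y + 1" using rank by (auto simp: rank_function_def)
    moreover have B: "?B x = insert y (?B y)"
    proof (intro equalityI subsetI)
      fix z assume z: "z \<in> insert y (?B y)"
      show "z \<in> ?B x"
      proof (cases "z = y")
        case False
        then have "(z, y) \<in> R" "z \<in> C" "(y, x) \<in> R" "z \<noteq> y" using z y by auto
        then show ?thesis using R_trans R_antisym by blast
      qed (use y in simp)
    qed (use y in auto)
    have "card (?B x) = Suc (card (?B y))"
      unfolding B using chain_finite[OF ch] by (subst card_insert_disjoint) auto
    moreover have "r y = card (?B y)"
      using y \<open>card (?B x) = Suc (card (?B y))\<close> by (intro less.hyps) auto
    ultimately show ?thesis by simp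
  qed
qed

text \<open>Two comparable elements lie in a common maximal chain, where the rank counts the
  elements strictly below.\<close>

lemma rank_strict_mono:
  assumes "(x, y) \<in> R" "x \<noteq> y"
  shows "r x < r y"
proof -
  have "{x, y} \<in> Chains R" using assms R_refl R_in by (auto simp: Chains_def)
  then obtain C where C: "maximal_chain R C" "{x, y} \<subseteq> C" by (rule maximal_chain_extension)
  have "{z \<in> C. (z, x) \<in> R \<and> z \<noteq> x} \<subset> {z \<in> C. (z, y) \<in> R \<and> z \<noteq> y}"
    using assms C R_trans R_antisym by blast
  moreover have "finite C" using C chain_finite by (auto simp: maximal_chain_def)
  ultimately show ?thesis
    using C rank_eq_card_below by (simp add: psubset_card_mono)
qed

lemma rank_inj_on_chain:
  assumes "C \<in> Chains R"
  shows "inj_on r C"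
proof (rule inj_onI)
  fix x y assume "x \<in> C" "y \<in> C" "r x = r y"
  then show "x = y"
    using assms rank_strict_mono[of x y] rank_strict_mono[of y x] by (auto simp: Chains_def)
qed

definition facets :: "'a set set" where
  "facets = {C \<in> Chains R. card C = m + 1}"

lemma facet_iff_maximal_chain: "C \<in> facets \<longleftrightarrow> maximal_chain R C"
proof
  assume "C \<in> facets"
  then have C: "C \<in> Chains R" "card C = m + 1" by (auto simp: facets_def)
  then obtain D where D: "maximal_chain R D" "C \<subseteq> D" using maximal_chain_extension by blast
  then have "card D = m + 1" "finite D"
    using graded chain_finite by (auto simp: graded_of_rank_def maximal_chain_def)
  then have "C = D" using C D card_subset_eq by metis
  then show "maximal_chain R C" using D by simp
next
  assume "maximal_chain R C"
  then have "C \<in> Chains R" "card C = m + 1"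
    using graded by (auto simp: graded_of_rank_def maximal_chain_def)
  then show "C \<in> facets" by (simp add: facets_def)
qed

lemma facet_extension:
  assumes "C \<in> Chains R"
  obtains D where "D \<in> facets" "C \<subseteq> D"
proof -
  obtain D where "maximal_chain R D" "C \<subseteq> D" using maximal_chain_extension[OF assms] .
  then show thesis using that[of D] by (simp only: facet_iff_maximal_chain)
qed

text \<open>This allows the vertices of every facet to be numbered by rank, which numbers the
  vertices of a common face consistently.\<close>

lemma facet_rank_bij:
  assumes "C \<in> facets"
  shows "bij_betw r C {..m}"
proof -
  have C: "C \<in> Chains R" "card C = m + 1" "finite C"
    using assms chain_finite by (auto simp: facets_def)
  have inj: "inj_on r C" using rank_inj_on_chain C by blast
  have "r x \<le> m" if x: "x \<in> C" for x
  proof -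
    have "r x = card {y \<in> C. (y, x) \<in> R \<and> y \<noteq> x}"
      using rank_eq_card_below x assms facet_iff_maximal_chain by blast
    also have "\<dots> < card C" using C x by (intro psubset_card_mono) auto
    finally show ?thesis using C by simp
  qed
  then have "r ` C \<subseteq> {..m}" by auto
  moreover have "card (r ` C) = card {..m}" using inj C by (simp add: card_image)
  ultimately have "r ` C = {..m}" by (intro card_subset_eq) auto
  then show ?thesis using inj by (simp add: bij_betw_def)
qed

lemma order_complex_iff: "B \<in> order_complex R \<longleftrightarrow> B \<in> Chains R \<and> B \<noteq> {}"
  unfolding order_complex_def using chain_finite by blast

section \<open>Consequences of the manifold hypothesis for facets and ridges\<close>

definition ridge_completions :: "'a set \<Rightarrow> 'a set" where
  "ridge_completions \<rho> = {w. w \<notin> \<rho> \<and> insert w \<rho> \<in> facets}"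

text \<open>Two facets through the same ridge both carry each of the ranks \<open>0, ..., m\<close>
  once, so the exchanged vertices have the one rank that the ridge lacks.\<close>

lemma rank_ridge_completion:
  assumes C: "C \<in> facets" "x \<in> C" and w: "w \<in> ridge_completions (C - {x})"
  shows "r w = r x"
proof -
  have 1: "bij_betw r C {..m}" "bij_betw r (insert w (C - {x})) {..m}"
    using C w facet_rank_bij by (auto simp: ridge_completions_def)
  have 2: "r ` (C - {x}) = {..m} - {r x}"
    using 1(1) C by (auto simp: bij_betw_def inj_on_def)
  have "w \<notin> C - {x}" using w by (auto simp: ridge_completions_def)
  then have "r w \<notin> r ` (C - {x})"
    using 1(2) by (auto simp: bij_betw_def inj_on_def)
  moreover have "r w \<in> {..m}" using 1(2) by (auto simp: bij_betw_def)
  ultimately show ?thesis using 2 by auto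
qed

lemma dimension_eq_rank:
  assumes "homology_manifold n (geometric_realization (order_complex R))"
  shows "n = m"
proof (rule ccontr)
  assume nm: "n \<noteq> m"
  let ?X = "geometric_realization (order_complex R)"
  have "{} \<in> Chains R" by (auto simp: Chains_def)
  then obtain C where C: "C \<in> facets" using facet_extension by blast
  then have "finite C" "card C = m + 1" "C \<in> Chains R" "C \<noteq> {}"
    using chain_finite by (auto simp: facets_def)
  obtain v where "bij_betw v {..m} C"
    using bij_betw_inv_into[OF facet_rank_bij[OF C]] by blast
  then have v: "inj_on v {..m}" "v ` {..m} = C" by (auto simp: bij_betw_def)
  have "\<not> trivial_group (local_homology_group (int m) ?X (barycentre (v ` {..m})))"
  proof (rule local_homology_maximal_simplex[OF v(1)])
    show "B \<in> order_complex R" if "B \<subseteq> v ` {..m}" "B \<noteq> {}" for B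
      using that v(2) chain_mono \<open>C \<in> Chains R\<close> by (auto simp: order_complex_iff)
    show "B = v ` {..m}" if "B \<in> order_complex R" "v ` {..m} \<subseteq> B" for B
      using that v(2) C by (auto simp: order_complex_iff facet_iff_maximal_chain maximal_chain_def)
  qed
  moreover have "barycentre C \<in> topspace ?X"
    using \<open>finite C\<close> \<open>C \<in> Chains R\<close> \<open>C \<noteq> {}\<close>
    by (intro barycentre_in_realization) (auto simp: order_complex_iff)
  then have "trivial_group (local_homology_group (int m) ?X (barycentre C))"
    using assms nm unfolding homology_manifold_def by fastforce
  ultimately show False using v(2) by simp
qed

text \<open>The ridge has \<open>n\<close> vertices, so its barycentre is tested in the one degree
  in which the local homology is infinite cyclic. The premise \<open>n \<noteq> 0\<close> makes the
  ridge nonempty, so that it has a barycentre.\<close>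

lemma card_ridge_completions:
  assumes man: "homology_manifold n (geometric_realization (order_complex R))" and "n \<noteq> 0"
    and C: "C \<in> facets" "x \<in> C"
  shows "card (ridge_completions (C - {x})) = 2"
proof -
  let ?K = "order_complex R"
  define \<rho> where "\<rho> = C - {x}"
  define W where "W = ridge_completions \<rho>"
  let ?X = "geometric_realization ?K" and ?Y = "geometric_realization (book \<rho> W)"
  let ?p = "barycentre \<rho>"
  have nm: "n = m" using dimension_eq_rank[OF man] .
  have Cf: "C \<in> Chains R" "card C = m + 1" "finite C"
    using C chain_finite unfolding facets_def by blast+
  have \<rho>: "finite \<rho>" "card \<rho> = n" "\<rho> \<noteq> {}" "\<rho> \<in> ?K"
  proof -
    show f: "finite \<rho>" "card \<rho> = n" using Cf C nm by (auto simp: \<rho>_def)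
    then show "\<rho> \<noteq> {}" using \<open>n \<noteq> 0\<close> by auto
    then show "\<rho> \<in> ?K" using chain_mono[OF Cf(1)] by (auto simp: order_complex_iff \<rho>_def)
  qed
  have W: "\<rho> \<inter> W = {}" "x \<in> W"
    using C by (auto simp: W_def ridge_completions_def \<rho>_def insert_absorb)
  have "W \<subseteq> P"
    using chain_subset by (auto simp: W_def ridge_completions_def facets_def)
  then have finW: "finite W" using fin finite_subset by blast
  have bookK: "book \<rho> W \<subseteq> ?K"
    using chain_mono by (auto simp: book_def order_complex_iff W_def ridge_completions_def facets_def)
  have pX: "?p \<in> topspace ?X" using \<rho> by (intro barycentre_in_realization)
  \<comment> \<open>The open star of \<rho>. It lies in the book, because a facet containing the
    support of such a point contains \<rho> and has only one further vertex.\<close>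
  define N where "N = (\<Inter>a\<in>\<rho>. {t \<in> topspace ?X. 0 < t a}) \<inter> topspace ?X"
  have N: "openin ?X N"
    unfolding N_def using \<rho>
    by (intro openin_INT openin_realization_less continuous_intros) auto
  have pN: "?p \<in> N" using pX \<rho> by (auto simp: N_def barycentre_def card_gt_0_iff)
  have NY: "N \<subseteq> topspace ?Y"
  proof
    fix t assume t: "t \<in> N"
    then have tX: "t \<in> topspace ?X" and pos: "\<And>a. a \<in> \<rho> \<Longrightarrow> 0 < t a" by (auto simp: N_def)
    define B where "B = {v. t v \<noteq> 0}"
    have "a \<in> B" if "a \<in> \<rho>" for a using pos[OF that] by (simp add: B_def)
    then have B: "B \<in> Chains R" "B \<noteq> {}" "\<rho> \<subseteq> B"
      using realization_support[OF tX] unfolding B_def[symmetric] order_complex_iff by blast+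
    obtain D where D: "D \<in> facets" "B \<subseteq> D" using facet_extension[OF B(1)] .
    then have "card (D - \<rho>) = 1"
      using B \<rho> nm by (subst card_Diff_subset) (auto simp: facets_def)
    then obtain w where "D - \<rho> = {w}" by (auto simp: card_1_singleton_iff)
    then have "D = insert w \<rho>" "w \<notin> \<rho>" using D B by auto
    then have "w \<in> W" "B \<subseteq> insert w \<rho>" using D by (auto simp: W_def ridge_completions_def)
    then have "B \<in> book \<rho> W" using B by (auto simp: book_def)
    then show "t \<in> topspace ?Y" using tX by (simp add: realization_iff B_def)
  qed
  let ?T = "topspace ?X - {?p}" and ?U = "topspace ?X - topspace ?Y"
  have YX: "topspace ?Y \<subseteq> topspace ?X" using realization_mono[OF bookK] .
  have eqY: "?Y = subtopology ?X (topspace ?Y)" using realization_subtopology[OF bookK] .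
  have "Hausdorff_space ?X"
    unfolding geometric_realization_def
    by (intro Hausdorff_space_subtopology) (simp add: Hausdorff_space_product_topology)
  then have "openin ?X ?T" using pX by (simp add: openin_diff closedin_Hausdorff_singleton)
  then have Tint: "?X interior_of ?T = ?T" by (simp add: interior_of_eq)
  \<comment> \<open>The part outside the book stays off the open star even after closure, hence off
    the barycentre; this is the condition for excising it.\<close>
  have "?X closure_of ?U \<subseteq> topspace ?X - N"
    using NY N by (intro closure_of_minimal) (auto simp: openin_closedin_eq)
  then have cond: "?X closure_of ?U \<subseteq> ?X interior_of ?T" using pN Tint by auto
  have "relative_homology_group i (subtopology ?X (topspace ?X - ?U)) (?T - ?U)
      \<cong> relative_homology_group i (subtopology ?X (topspace ?X)) ?T" for i
    by (rule is_isoI, rule homology_excision_axiom[OF cond]) auto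
  moreover have "topspace ?X - ?U = topspace ?Y" "?T - ?U = topspace ?Y - {?p}" using YX by auto
  ultimately have exc: "local_homology_group i ?Y ?p \<cong> local_homology_group i ?X ?p" for i
    using eqY by simp
  have "local_homology_group (int n) ?X ?p \<cong> integer_group"
    using man pX by (auto simp: homology_manifold_def)
  then have Z: "local_homology_group (int n) ?Y ?p \<cong> integer_group"
    using exc iso_trans by blast
  have "card W \<noteq> 0" using finW W by auto
  moreover have "card W \<noteq> 1"
  proof
    assume "card W = 1"
    then have "W = {x}" using W by (auto simp: card_1_singleton_iff)
    then have "trivial_group (local_homology_group (int n) ?Y ?p)"
      using local_homology_one_page[OF \<rho>(1,3)] W by blast
    then have "trivial_group integer_group"
      using Z isomorphic_group_triviality group_integer_group group_relative_homology_group by blast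
    then have "(UNIV :: int set) = {0}"
      by (simp only: trivial_group_def carrier_integer_group one_integer_group)
    then have "(1 :: int) \<in> {0}" by blast
    then show False by simp
  qed
  moreover have "\<not> 3 \<le> card W"
  proof
    assume "3 \<le> card W"
    then obtain V where "V \<subseteq> W" "card V = 3" using obtain_subset_with_card_n by metis
    then obtain a b c where "a \<in> W" "b \<in> W" "c \<in> W" "a \<noteq> b" "b \<noteq> c" "a \<noteq> c"
      by (auto simp: card_3_iff)
    then show False using local_homology_three_pages[OF \<rho>(1,3) finW W(1)] Z \<rho>(2) by blast
  qed
  ultimately show ?thesis unfolding W_def \<rho>_def by linarith
qed

end

section \<open>Cycles modulo 2 in contractible spaces\<close>

text \<open>Grouped by the value of \<open>g\<close>, each \<open>h y\<close> occurs an even number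
  of times. Cancellation modulo 2 is recorded in this way with integer coefficients.\<close>

lemma sum_even_fibres:
  fixes h :: "'b \<Rightarrow> 'c \<Rightarrow>\<^sub>0 int"
  assumes Z: "finite Z" and even: "\<And>z. z \<in> Z \<Longrightarrow> even (card {z' \<in> Z. g z' = g z})"
  obtains d where "(\<Sum>z\<in>Z. h (g z)) = frag_cmul 2 d"
proof
  have const: "(\<Sum>z\<in>A. c) = frag_cmul (int (card A)) c" if "finite A" for A :: "'a set" and c :: "'c \<Rightarrow>\<^sub>0 int"
    using that by (induction A rule: finite_induct) (simp_all add: frag_cmul_distrib)
  have "(\<Sum>z\<in>Z. h (g z)) = (\<Sum>y\<in>g ` Z. \<Sum>z\<in>{z \<in> Z. g z = y}. h (g z))"
    by (rule sum.image_gen[OF Z])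
  also have "\<dots> = (\<Sum>y\<in>g ` Z. frag_cmul 2 (frag_cmul (int (card {z \<in> Z. g z = y}) div 2) (h y)))"
  proof (rule sum.cong[OF refl])
    fix y assume y: "y \<in> g ` Z"
    have "(\<Sum>z\<in>{z \<in> Z. g z = y}. h (g z)) = (\<Sum>z\<in>{z \<in> Z. g z = y}. h y)"
      by (rule sum.cong) auto
    also have "\<dots> = frag_cmul (int (card {z \<in> Z. g z = y})) (h y)"
      using Z by (intro const) simp
    also have "int (card {z \<in> Z. g z = y}) = 2 * (int (card {z \<in> Z. g z = y}) div 2)"
      using even y by fastforce
    finally show "(\<Sum>z\<in>{z \<in> Z. g z = y}. h (g z))
        = frag_cmul 2 (frag_cmul (int (card {z \<in> Z. g z = y}) div 2) (h y))"
      by (simp only: frag_cmul_cmul)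
  qed
  also have "\<dots> = frag_cmul 2 (\<Sum>y\<in>g ` Z. frag_cmul (int (card {z \<in> Z. g z = y}) div 2) (h y))"
    by (rule frag_cmul_sum[symmetric])
  finally show "(\<Sum>z\<in>Z. h (g z)) = frag_cmul 2 (\<Sum>y\<in>g ` Z. frag_cmul (int (card {z \<in> Z. g z = y}) div 2) (h y))" .
qed

lemma hom_homologous_rel_set:
  "homologous_rel_set p X S \<in> hom (relcycle_group p X S) (relative_homology_group (int p) X S)"
  using normal.r_coset_hom_Mod[OF normal_subgroup_singular_relboundary_relcycle[of p X S]]
  by (simp add: right_coset_singular_relboundary nontrivial_relative_homology_group)

text \<open>Homology in degree 0 of a nonempty path-connected space is infinite cyclic, hence
  torsion-free. It does not vanish, so degree 0 cannot be treated like the positive degrees.\<close>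

lemma relboundary_if_twice_relboundary_degree_0:
  assumes X: "path_connected_space X" "topspace X \<noteq> {}" and d: "singular_relcycle 0 X {} d"
    and b: "singular_relboundary 0 X {} (frag_cmul 2 d)"
  shows "singular_relboundary 0 X {} d"
proof -
  let ?G = "homology_group 0 X" and ?h = "homologous_rel_set 0 X {}"
  obtain \<phi> where \<phi>: "\<phi> \<in> iso ?G integer_group"
    using isomorphic_integer_zeroth_homology_group[OF X] by (auto simp: is_iso_def)
  then have \<phi>h: "\<phi> \<in> hom ?G integer_group" and \<phi>i: "inj_on \<phi> (carrier ?G)"
    by (auto simp: iso_def bij_betw_def)
  have hh: "?h \<in> hom (relcycle_group 0 X {}) ?G"
    using hom_homologous_rel_set[of 0 X "{}"] by simp
  have dc: "d \<in> carrier (relcycle_group 0 X {})" using d by simp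
  have hd: "?h d \<in> carrier ?G" using hom_in_carrier[OF hh dc] .
  have two: "frag_cmul 2 d = d + d" using frag_cmul_distrib[of 1 1 d] by simp
  have one: "?h c = \<one>\<^bsub>?G\<^esub> \<longleftrightarrow> singular_relboundary 0 X {} c" for c
    using homologous_rel_set_eq_relboundary[of 0 X "{}" c] one_relative_homology_group[of 0 X "{}"] by simp
  have "\<phi> (?h d) + \<phi> (?h d) = \<phi> (?h d \<otimes>\<^bsub>?G\<^esub> ?h d)"
    using hom_mult[OF \<phi>h hd hd] by simp
  also have "?h d \<otimes>\<^bsub>?G\<^esub> ?h d = ?h (frag_cmul 2 d)"
    using hom_mult[OF hh dc dc] unfolding two by simp
  also have "?h (frag_cmul 2 d) = \<one>\<^bsub>?G\<^esub>" using one b by blast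
  also have "\<phi> \<one>\<^bsub>?G\<^esub> = 0" using hom_one[OF \<phi>h] by simp
  finally have "\<phi> (?h d) = \<phi> \<one>\<^bsub>?G\<^esub>" using hom_one[OF \<phi>h] by simp
  then have "?h d = \<one>\<^bsub>?G\<^esub>"
    using inj_onD[OF \<phi>i] hd group.is_monoid[OF group_relative_homology_group] monoid.one_closed by blast
  then show ?thesis using one by blast
qed

text \<open>A Bockstein argument: \<open>2 \<partial>d = \<partial>\<partial>c = 0\<close> makes
  \<open>d\<close> an integral cycle. It bounds because homology vanishes in positive degree, and in
  degree 0 because \<open>2 d\<close> bounds and there is no torsion. If
  \<open>d = \<partial>e\<close>, then \<open>c - 2 e\<close> is an integral cycle of positive
  degree and bounds as well.\<close>

lemma mod_2_cycle_is_boundary_if_contractible: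
  assumes X: "contractible_space X" "topspace X \<noteq> {}" and c: "singular_chain (Suc q) X c"
    and d: "chain_boundary (Suc q) c = frag_cmul 2 d"
  obtains e f where "singular_chain (Suc (Suc q)) X f"
    "c = frag_cmul 2 e + chain_boundary (Suc (Suc q)) f"
proof -
  have triv: "trivial_group (homology_group (int p) X)" if "p \<noteq> 0" for p
    using trivial_reduced_homology_group_contractible_space[OF X(1), of "int p"] that
    by (simp add: un_reduced_homology_group)
  have "singular_chain q X (frag_cmul 2 d)"
    using singular_chain_boundary[OF c] d by simp
  then have dch: "singular_chain q X d" by (auto simp: singular_chain_def)
  have "frag_cmul 2 (chain_boundary q d) = chain_boundary q (chain_boundary (Suc q) c)"
    by (simp add: d chain_boundary_cmul)
  also have "\<dots> = 0" by (rule chain_boundary_boundary_alt[OF c])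
  finally have "chain_boundary q d = 0" by simp
  then have dcyc: "singular_relcycle q X {} d" using dch by (simp add: singular_cycle)
  have 2: "singular_relboundary q X {} (frag_cmul 2 d)"
    using c d by (auto simp: singular_boundary)
  have "singular_relboundary q X {} d"
  proof (cases "q = 0")
    case True
    then show ?thesis
      using relboundary_if_twice_relboundary_degree_0[OF contractible_imp_path_connected_space[OF X(1)] X(2)] dcyc 2
      by simp
  next
    case False
    then show ?thesis using relboundary_if_trivial[OF triv dcyc] by simp
  qed
  then obtain e where e: "singular_chain (Suc q) X e" "chain_boundary (Suc q) e = d"
    by (auto simp: singular_boundary)
  have "singular_relcycle (Suc q) X {} (c - frag_cmul 2 e)"
    using c e d by (simp add: singular_cycle singular_chain_diff singular_chain_cmul
        chain_boundary_diff chain_boundary_cmul)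
  then have "singular_relboundary (Suc q) X {} (c - frag_cmul 2 e)"
    using relboundary_if_trivial[OF triv] by blast
  then obtain f where "singular_chain (Suc (Suc q)) X f"
    "chain_boundary (Suc (Suc q)) f = c - frag_cmul 2 e"
    by (auto simp: singular_boundary)
  then show thesis by (intro that[of f e]) auto
qed

section \<open>The bounded complex and its cycle modulo 2\<close>

context graded_poset
begin

lemma bounded_order_complexI:
  assumes B: "B \<in> Chains R" "B \<noteq> {}" and le: "\<And>x. x \<in> B \<Longrightarrow> r x \<le> k"
  shows "B \<in> bounded_order_complex k R r"
proof -
  obtain x where x: "x \<in> B" "\<forall>z\<in>B. (x, z) \<in> R" using chain_least[OF B] by blast
  obtain y where y: "y \<in> B" "\<forall>z\<in>B. (z, y) \<in> R" using chain_greatest[OF B] by blast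
  have "r y \<le> r x + k" using le[OF y(1)] by simp
  then show ?thesis
    unfolding bounded_order_complex_def using x y B order_complex_iff by blast
qed

text \<open>The ranks in such a chain are distinct and lie among \<open>k + 1\<close> consecutive
  values. So simplices with \<open>k + 1\<close> vertices are maximal in the bounded
  complex.\<close>

lemma card_bounded_order_complex:
  assumes "B \<in> bounded_order_complex k R r"
  shows "card B \<le> k + 1"
proof -
  obtain x y where B: "B \<in> Chains R" and xy: "\<And>z. z \<in> B \<Longrightarrow> (x, z) \<in> R \<and> (z, y) \<in> R" "r y \<le> r x + k"
    using assms order_complex_iff unfolding bounded_order_complex_def by blast
  have mono: "r a \<le> r b" if "(a, b) \<in> R" for a b
    using rank_strict_mono[OF that] by (cases "a = b") auto
  have "r z \<in> {r x..r x + k}" if "z \<in> B" for z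
    using mono xy(1)[OF that] xy(2) by fastforce
  then have "card (r ` B) \<le> card {r x..r x + k}" by (intro card_mono) auto
  then show ?thesis using card_image[OF rank_inj_on_chain[OF B]] by simp
qed

text \<open>With vertices numbered by rank, the face opposite to rank \<open>i\<close> depends only
  on the remaining vertices. Hence equal faces of different lower parts are equal singular
  simplices, and they cancel modulo 2 for each \<open>i\<close> separately.\<close>

lemma bounded_complex_not_contractible_Suc:
  assumes man: "homology_manifold n (geometric_realization (order_complex R))" and n: "n \<noteq> 0"
    and k: "k = Suc q" "k \<le> m"
  shows "\<not> contractible_space (geometric_realization (bounded_order_complex k R r))"
proof
  define K where "K = bounded_order_complex k R r"
  let ?X = "geometric_realization K"
  assume "contractible_space (geometric_realization (bounded_order_complex k R r))"
  then have contr: "contractible_space ?X" by (simp add: K_def)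
  have "{} \<in> Chains R" by (auto simp: Chains_def)
  then obtain C0 where C0: "C0 \<in> facets" using facet_extension by blast
  define T where "T = {x \<in> C0. k < r x}"
  \<comment> \<open>The facets of the link of \<open>T\<close>. As \<open>T\<close> uses up the
    ranks \<open>k + 1, ..., m\<close>, each member of \<open>Z\<close> has exactly the ranks
    \<open>0, ..., k\<close>.\<close>
  define Z where "Z = {z. z \<inter> T = {} \<and> z \<union> T \<in> facets}"
  have "r ` T = {i \<in> r ` C0. k < i}" by (auto simp: T_def)
  also have "r ` C0 = {..m}" using facet_rank_bij[OF C0] by (simp add: bij_betw_def)
  also have "{i \<in> {..m}. k < i} = {k<..m}" by auto
  finally have rT: "r ` T = {k<..m}" .
  have Zch: "z \<in> Chains R" if "z \<in> Z" for z
    using that chain_mono[of "z \<union> T" z] by (auto simp: Z_def facets_def)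
  have finZ: "finite Z"
    by (rule finite_subset[of _ "Pow P"]) (use Zch chain_subset in blast, simp add: fin)
  have rz: "bij_betw r z {..k}" if "z \<in> Z" for z
  proof -
    have bij: "bij_betw r (z \<union> T) {..m}" and dis: "z \<inter> T = {}"
      using that facet_rank_bij by (auto simp: Z_def)
    then have "r ` z = r ` (z \<union> T) - r ` T"
      by (auto simp: bij_betw_def inj_on_def)
    also have "\<dots> = {..k}" using bij rT k by (auto simp: bij_betw_def)
    finally show ?thesis using bij by (auto simp: bij_betw_def inj_on_Un)
  qed
  define V where "V z = inv_into z r" for z
  have V: "bij_betw (V z) {..k} z" if "z \<in> Z" for z
    using bij_betw_inv_into[OF rz[OF that]] by (simp add: V_def)
  have Vinj: "inj_on (V z) {..k}" and Vim: "V z ` {..k} = z" if "z \<in> Z" for z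
    using V[OF that] by (auto simp: bij_betw_def)
  have rV: "r (V z i) = i" if "z \<in> Z" "i \<le> k" for z i
    using f_inv_into_f[of i r z] rz[OF that(1)] that(2) by (simp add: V_def bij_betw_def)
  have Vin: "V z i \<in> z" if "z \<in> Z" "i \<le> k" for z i
    using Vim[OF that(1)] that(2) by blast
  have Vr: "V z (r x) = x" if "z \<in> Z" "x \<in> z" for z x
    using that rz[OF that(1)] by (simp add: V_def bij_betw_def)
  have ZK: "B \<in> K" if "z \<in> Z" "B \<subseteq> z" "B \<noteq> {}" for z B
    unfolding K_def
  proof (rule bounded_order_complexI)
    show "B \<in> Chains R" using chain_mono[OF Zch] that by blast
    show "r x \<le> k" if "x \<in> B" for x
      using bij_betwE[OF rz[OF \<open>z \<in> Z\<close>]] \<open>B \<subseteq> z\<close> that by blast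
  qed (rule that)
  have ZK': "B \<in> K" if "z \<in> Z" "B \<subseteq> V z ` {..k}" "B \<noteq> {}" for z B
    using ZK that Vim by simp
  have cardZ: "card z = k + 1" "finite z" if "z \<in> Z" for z
    using bij_betw_same_card[OF rz[OF that]] bij_betw_finite[OF rz[OF that]] by auto
  let ?s = "\<lambda>z. vertex_simplex k (V z)"
  let ?g = "\<lambda>i z. z - {V z i}"
  \<comment> \<open>The affine simplex on \<rho> with its vertices in order of rank;
    \<open>skip i\<close> jumps over the rank that \<rho> lacks.\<close>
  let ?h = "\<lambda>i \<rho>. frag_of (vertex_simplex q (\<lambda>j. inv_into \<rho> r (skip i j)))"
  have face: "frag_of (singular_face (Suc q) i (vertex_simplex (Suc q) (V z))) = ?h i (?g i z)"
    if z: "z \<in> Z" and i: "i \<le> k" for z i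
  proof -
    have i': "i \<le> Suc q" using i k by simp
    have "V z (skip i j) = inv_into (?g i z) r (skip i j)" if "j \<le> q" for j
    proof -
      have "skip i j \<in> {..Suc q} - {i}" using that image_skip[OF i'] by blast
      then have j: "skip i j \<le> k" "skip i j \<noteq> i" using k by auto
      have "V z (skip i j) \<noteq> V z i" using rV[OF z j(1)] rV[OF z i] j(2) by metis
      then have "V z (skip i j) \<in> ?g i z" using Vin[OF z j(1)] by blast
      moreover have "inj_on r (?g i z)"
        using rz[OF z] by (auto simp: bij_betw_def intro: inj_on_subset)
      ultimately have "inv_into (?g i z) r (r (V z (skip i j))) = V z (skip i j)" by simp
      then show ?thesis using rV[OF z j(1)] by simp
    qed
    then show ?thesis
      unfolding singular_face_vertex_simplex[OF i'] frag_of_eq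
      by (intro vertex_simplex_cong) simp
  qed
  have fibre: "even (card {z' \<in> Z. ?g i z' = ?g i z})" if z: "z \<in> Z" and i: "i \<le> k" for z i
  proof -
    let ?x = "V z i" and ?\<rho> = "?g i z"
    have CF: "z \<union> T \<in> facets" "?x \<in> z \<union> T" and dis: "z \<inter> T = {}"
      using z Vin[OF z i] by (auto simp: Z_def)
    let ?W = "ridge_completions (z \<union> T - {?x})"
    have eq: "z \<union> T - {?x} = ?\<rho> \<union> T" using dis Vin[OF z i] by blast
    \<comment> \<open>A member of the fibre is \<rho> with one vertex added, which completes the
      ridge \<open>?\<rho> \<union> T\<close> to a facet. Conversely a completing vertex has rank
      \<open>i\<close> again, so it is the one that \<open>?g i\<close> removes.\<close>
    have "{z' \<in> Z. ?g i z' = ?\<rho>} = (\<lambda>w. insert w ?\<rho>) ` ?W"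
    proof (intro equalityI subsetI)
      fix z' assume "z' \<in> {z' \<in> Z. ?g i z' = ?\<rho>}"
      then have z': "z' \<in> Z" "?g i z' = ?\<rho>" by auto
      have w: "V z' i \<in> z'" using Vin[OF z'(1) i] .
      have ins: "insert (V z' i) ?\<rho> = z'" using w z'(2) by blast
      have "V z' i \<notin> ?\<rho> \<union> T" using w z' by (auto simp: Z_def)
      moreover have "insert (V z' i) (?\<rho> \<union> T) \<in> facets"
        using z'(1) ins by (simp add: Z_def flip: Un_insert_left)
      ultimately have "V z' i \<in> ?W" unfolding eq ridge_completions_def by blast
      then show "z' \<in> (\<lambda>w. insert w ?\<rho>) ` ?W" using ins by blast
    next
      fix z' assume "z' \<in> (\<lambda>w. insert w ?\<rho>) ` ?W"
      then obtain w where w: "w \<in> ?W" "z' = insert w ?\<rho>" by blast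
      then have w': "w \<notin> ?\<rho>" "w \<notin> T" "insert w (?\<rho> \<union> T) \<in> facets"
        unfolding eq ridge_completions_def by auto
      then have z': "z' \<in> Z" using w(2) dis by (auto simp: Z_def)
      have "r w = i" using rank_ridge_completion[OF CF w(1)] rV[OF z i] by simp
      then have "V z' i = w" using Vr[OF z', of w] w(2) by simp
      then show "z' \<in> {z' \<in> Z. ?g i z' = ?\<rho>}" using z' w(2) w'(1) by auto
    qed
    moreover have "inj_on (\<lambda>w. insert w ?\<rho>) ?W"
      unfolding eq ridge_completions_def by (rule inj_onI) blast
    ultimately have "card {z' \<in> Z. ?g i z' = ?\<rho>} = 2"
      using card_ridge_completions[OF man n CF] by (simp add: card_image)
    then show ?thesis by simp
  qed
  define c where "c = (\<Sum>z\<in>Z. frag_of (?s z))"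
  have ss: "singular_simplex k ?X (?s z)" if "z \<in> Z" for z
    using Vinj[OF that] ZK'[OF that] by (rule singular_simplex_vertex_simplex)
  have cch: "singular_chain (Suc q) ?X c"
    unfolding c_def using ss k(1) by (intro singular_chain_sum) (simp add: singular_chain_of)
  \<comment> \<open>Half of the sum of the \<open>i\<close>-th faces. The sign
    \<open>(-1) ^ i\<close> is the same for all of them and does not disturb the
    cancellation.\<close>
  define d where "d i = (SOME d. (\<Sum>z\<in>Z. ?h i (?g i z)) = frag_cmul 2 d)" for i
  have d: "(\<Sum>z\<in>Z. ?h i (?g i z)) = frag_cmul 2 (d i)" if "i \<le> k" for i
    unfolding d_def by (rule someI_ex, rule sum_even_fibres[OF finZ fibre[OF _ that], of "?h i"]) blast+
  have bs: "chain_boundary (Suc q) (frag_of (?s z)) = (\<Sum>i\<le>Suc q. frag_cmul ((-1) ^ i) (?h i (?g i z)))"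
    if z: "z \<in> Z" for z
  proof -
    have "chain_boundary (Suc q) (frag_of (?s z))
        = (\<Sum>i\<le>Suc q. frag_cmul ((-1) ^ i) (frag_of (singular_face (Suc q) i (vertex_simplex (Suc q) (V z)))))"
      unfolding chain_boundary_of k(1) by (simp only: nat.distinct if_False)
    also have "\<dots> = (\<Sum>i\<le>Suc q. frag_cmul ((-1) ^ i) (?h i (?g i z)))"
    proof (rule sum.cong[OF refl])
      fix i assume "i \<in> {..Suc q}"
      then have "i \<le> k" using k(1) by simp
      from face[OF z this] show "frag_cmul ((-1) ^ i) (frag_of (singular_face (Suc q) i (vertex_simplex (Suc q) (V z))))
          = frag_cmul ((-1) ^ i) (?h i (?g i z))" by (rule arg_cong)
    qed
    finally show ?thesis .
  qed
  have "chain_boundary (Suc q) c = (\<Sum>z\<in>Z. \<Sum>i\<le>Suc q. frag_cmul ((-1) ^ i) (?h i (?g i z)))"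
    unfolding c_def chain_boundary_sum o_def by (rule sum.cong[OF refl bs])
  also have "\<dots> = (\<Sum>i\<le>Suc q. \<Sum>z\<in>Z. frag_cmul ((-1) ^ i) (?h i (?g i z)))"
    by (rule sum.swap)
  also have "\<dots> = (\<Sum>i\<le>Suc q. frag_cmul 2 (frag_cmul ((-1) ^ i) (d i)))"
  proof (rule sum.cong[OF refl])
    fix i assume "i \<in> {..Suc q}"
    then have i: "i \<le> k" using k by simp
    have "(\<Sum>z\<in>Z. frag_cmul ((-1) ^ i) (?h i (?g i z))) = frag_cmul ((-1) ^ i) (\<Sum>z\<in>Z. ?h i (?g i z))"
      by (rule frag_cmul_sum[symmetric])
    then show "(\<Sum>z\<in>Z. frag_cmul ((-1) ^ i) (?h i (?g i z))) = frag_cmul 2 (frag_cmul ((-1) ^ i) (d i))"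
      unfolding d[OF i] by (simp add: mult.commute)
  qed
  also have "\<dots> = frag_cmul 2 (\<Sum>i\<le>Suc q. frag_cmul ((-1) ^ i) (d i))"
    by (rule frag_cmul_sum[symmetric])
  finally have bd: "chain_boundary (Suc q) c = frag_cmul 2 (\<Sum>i\<le>Suc q. frag_cmul ((-1) ^ i) (d i))" .
  define z0 where "z0 = C0 - T"
  have "z0 \<union> T = C0" "z0 \<inter> T = {}" by (auto simp: z0_def T_def)
  then have z0: "z0 \<in> Z" using C0 by (simp add: Z_def)
  have "topspace ?X \<noteq> {}"
    using barycentre_in_realization[of z0 K] ZK[OF z0] cardZ[OF z0] by fastforce
  then obtain e f where f: "singular_chain (Suc (Suc q)) ?X f"
    and cf: "c = frag_cmul 2 e + chain_boundary (Suc (Suc q)) f"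
    using mod_2_cycle_is_boundary_if_contractible[OF contr _ cch bd] by metis
  \<comment> \<open>The other lower parts have as many elements as \<open>z0\<close>, so none of
    them contains it and each avoids its barycentre. What remains of the cycle at that point is the
    one simplex on \<open>z0\<close>.\<close>
  let ?g0 = "- (\<Sum>z\<in>Z - {z0}. frag_of (?s z))"
  have "frag_of (?s z0) = frag_cmul 2 e + chain_boundary (Suc k) f + ?g0"
    using cf sum.remove[OF finZ z0, of "\<lambda>z. frag_of (?s z)"] k(1) by (simp add: c_def algebra_simps)
  moreover have "singular_chain k (subtopology ?X (topspace ?X - {barycentre (V z0 ` {..k})})) ?g0"
    unfolding singular_chain_minus
  proof (rule singular_chain_sum)
    fix z assume "z \<in> Z - {z0}"
    then have z: "z \<in> Z" "z \<noteq> z0" by auto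
    have "\<not> z0 \<subseteq> z" using card_subset_eq[of z z0] cardZ[OF z(1)] cardZ[OF z0] z(2) by auto
    show "singular_chain k (subtopology ?X (topspace ?X - {barycentre (V z0 ` {..k})})) (frag_of (?s z))"
      using Vim[OF z0] Vim[OF z(1)] cardZ[OF z0] \<open>\<not> z0 \<subseteq> z\<close>
      by (intro vertex_simplex_avoids_barycentre[OF Vinj[OF z(1)] ZK'[OF z(1)]]) auto
  qed
  moreover have "B = V z0 ` {..k}" if "B \<in> K" "V z0 ` {..k} \<subseteq> B" for B
  proof -
    have "card B \<le> k + 1" using card_bounded_order_complex that(1) by (simp add: K_def)
    moreover have "finite B"
      using that(1) chain_finite order_complex_iff by (auto simp: K_def bounded_order_complex_def)
    ultimately show ?thesis
      using card_seteq[of B z0] cardZ[OF z0] that(2) Vim[OF z0] by simp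
  qed
  ultimately show False
    using maximal_simplex_obstruction[OF Vinj[OF z0] ZK'[OF z0]] f k(1) by blast
qed

text \<open>Only singletons are simplices here, so a coordinate takes no values but 0 and 1. The
  coordinate at \<open>a\<close> takes both, at the vertices \<open>a\<close> and \<open>b\<close>,
  which contradicts connectedness.\<close>

lemma bounded_complex_not_contractible_0:
  assumes ab: "a \<in> P" "b \<in> P" "a \<noteq> b"
  shows "\<not> contractible_space (geometric_realization (bounded_order_complex 0 R r))"
proof
  let ?X = "geometric_realization (bounded_order_complex 0 R r)"
  assume "contractible_space ?X"
  then have "connected_space ?X"
    using contractible_imp_path_connected_space path_connected_imp_connected_space by blast
  then have "connectedin ?X (topspace ?X)" by (simp add: connectedin_topspace)
  then have con: "connected ((\<lambda>t. t a) ` topspace ?X)"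
    using connectedin_continuous_map_image[OF continuous_map_coordinate] by fastforce
  have 01: "t a = 0 \<or> t a = 1" if t: "t \<in> topspace ?X" for t
  proof -
    have "card {v. t v \<noteq> 0} \<le> 1"
      using card_bounded_order_complex[OF realization_support[OF t]] by simp
    moreover have "t a = 1" if "t a \<noteq> 0"
    proof -
      have "{v. t v \<noteq> 0} = {a}"
        using card_seteq[of "{v. t v \<noteq> 0}" "{a}"] realization_finite_support[OF t] calculation that by simp
      then show ?thesis using realization_sum_eq_1[OF t, of "{a}"] by simp
    qed
    ultimately show ?thesis by blast
  qed
  have single: "barycentre {x} \<in> topspace ?X" if "x \<in> P" for x
  proof -
    have "{x} \<in> order_complex R" using that R_refl by (auto simp: order_complex_iff Chains_def)
    then have "{x} \<in> bounded_order_complex 0 R r"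
      using that R_refl by (auto simp: bounded_order_complex_def)
    then show ?thesis by (intro barycentre_in_realization) auto
  qed
  have "barycentre {a} a = 1" "barycentre {b} a = 0" using ab by (auto simp: barycentre_def)
  then have "1 \<in> (\<lambda>t. t a) ` topspace ?X" "0 \<in> (\<lambda>t. t a) ` topspace ?X"
    using single ab by (metis image_eqI)+
  then have "{0..1} \<subseteq> (\<lambda>t. t a) ` topspace ?X"
    using connected_contains_Icc[OF con] by blast
  then have "1 / 2 \<in> (\<lambda>t. t a) ` topspace ?X" by (rule subsetD) simp
  then show False using 01 by force
qed

end

theorem corollary3p7:
  fixes P :: "'a set" and R :: "'a rel" and r :: "'a \<Rightarrow> nat"
    and X :: "'b topology" and n k :: nat
  assumes "finite_graded_poset P R r"
    and "homology_manifold n X"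
    and "triangulates (order_complex R) X"
    and "\<not> (n = 0 \<and> card P = 1)"
    and "k \<le> n"
  shows "\<not> contractible_space (geometric_realization (bounded_order_complex k R r))"
proof -
  obtain m where "graded_poset P R r m"
    using assms(1) by (auto simp: finite_graded_poset_def graded_poset_def)
  then interpret graded_poset P R r m .
  have man: "homology_manifold n (geometric_realization (order_complex R))"
    using homology_manifold_homeomorphic[OF assms(2)] assms(3) by (simp add: triangulates_def)
  have nm: "n = m" using dimension_eq_rank[OF man] .
  show ?thesis
  proof (cases k)
    case 0
    have "{} \<in> Chains R" by (auto simp: Chains_def)
    then obtain C where C: "C \<in> facets" using facet_extension by blast
    then have "C \<subseteq> P" "card C = n + 1" using chain_subset nm by (auto simp: facets_def)
    then have "n + 1 \<le> card P" using card_mono[OF fin] by metis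
    \<comment> \<open>For \<open>n \<noteq> 0\<close> a facet alone has at least two elements. For
      \<open>n = 0\<close> the fourth assumption rules out the one-point poset, whose complex is a
      point and hence contractible.\<close>
    then have "2 \<le> card P" using assms(4) by linarith
    then obtain A where "A \<subseteq> P" "card A = 2" using obtain_subset_with_card_n by metis
    then obtain a b where "a \<in> P" "b \<in> P" "a \<noteq> b" by (auto simp: card_2_iff)
    then show ?thesis using bounded_complex_not_contractible_0 0 by simp
  next
    \<comment> \<open>Here \<open>1 \<le> k \<le> n\<close>, so \<open>n \<noteq> 0\<close> and the
      ridges are nonempty.\<close>
    case (Suc q)
    then show ?thesis
      using bounded_complex_not_contractible_Suc[OF man _ Suc] assms(5) nm by simp
  qed
qed

end
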